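(* Let $M$ be a compact manifold equipped with a smooth volume element $d\mu$ and a Riemannian metric $h$. For any $C^\infty$-map $\varphi\colon M\to l^2$ satisfying $\int_M\varphi\,d\mu_1=0$ and $\varphi^*h_{l^2}\le h$, and for any nonzero $g^*\in\mathcal{M}^*$, we have $$\int_M\|\varphi\|^2\,d\mu_1\le \int_M(g^*,h)\,d\mu_1\Bigm/\lambda_1(d\mu,g^* ),\qquad(\ast)$$ which implies the weak-duality inequality $$\mathrm{Var}(d\mu,h)\le\frac{1}{\Lambda_1(d\mu,h)}.$$ Equality holds in $(\ast)$ if and only if the map $\varphi$ consists of functions minimizing the Rayleigh quotient $\mathrm{RQ}(u)=\int_M g^*(du,du)\,d\mu\big/\int_M u^2\,d\mu$ over all functions with mean value zero and $(g^*,\,h-\varphi^*h_{l^2})\equiv0$ holds on $M$. If $g^*$ is positive definite at every point of $M$, then these equality conditions imply that the map $\varphi$ consists of first eigenfunctions of $-\Delta_{(d\mu,g^* )}$ and that $\varphi$ is an isometric immersion with respect to $h$, i.e. $\varphi^*h_{l^2}=h$.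
   Context: Manifolds are smooth, connected and without boundary. Put $d\mu_1=d\mu/\int_M d\mu$. $l^2$ is the Hilbert space of square-summable real sequences, with norm $\|\cdot\|$ and standard Riemannian metric $h_{l^2}$. $\mathcal{M}^*$ is the set of all smooth sections $g^*$ of $S^2TM$ that are positive semidefinite on $T^*M$ at every point. For $g^*\in\mathcal{M}^*$ and a symmetric covariant 2-tensor field $k$, $(g^*,k)=g^{ij}k_{ij}$ is the pointwise pairing. For $g^*\in\mathcal{M}^*$ the Bakry-Émery Laplacian $\Delta_{(d\mu,g^* )}\colon C^\infty(M)\to C^\infty(M)$ is determined by $\int_M(\Delta_{(d\mu,g^* )}u)\,v\,d\mu=-\int_M g^*(du,dv)\,d\mu$ for all $u,v\in C^\infty(M)$. $\lambda_1(d\mu,g^* )=\inf\mathrm{RQ}(u)$, the infimum over nonzero $C^1$-functions $u$ with $\int_M u\,d\mu=0$; when $g^*$ is positive definite this is the smallest positive eigenvalue of $-\Delta_{(d\mu,g^* )}$, and first eigenfunctions are elements of the corresponding eigenspace. The right-hand side of $(\ast)$ is read as $+\infty$ if $\lambda_1(d\mu,g^* )=0$. A map $\varphi=(u_k)_{k\ge1}$ "consists of" functions of a given kind if each component $u_k$ is of that kind or is identically zero. $\mathrm{Var}(d\mu,h)$ is the supremum of $\int_M\|\varphi\|^2\,d\mu_1$ over all $C^\infty$-maps $\varphi\colon M\to l^2$ with $\varphi^*h_{l^2}\le h$ and $\int_M\varphi\,d\mu_1=0$. $\Lambda_1(d\mu,h)$ is the supremum of $\lambda_1(d\mu,g^*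 )\big/\int_M(g^*,h)\,d\mu_1$ over all nonzero $g^*\in\mathcal{M}^*$. *)

theory Defs
  imports "HOL-Analysis.Analysis"
begin

section \<open>The Hilbert space of square-summable real sequences\<close>

typedef l2 = "{x :: nat \<Rightarrow> real. summable (\<lambda>n. (x n)\<^sup>2)}"
  morphisms l2_nth Abs_l2
  by (rule exI[of _ "\<lambda>_. 0"]) simp

setup_lifting type_definition_l2

lemma l2_summable_sq: "summable (\<lambda>n. (l2_nth x n)\<^sup>2)"
  using l2_nth[of x] by simp

lemma summable_mult_of_sq:
  fixes x y :: "nat \<Rightarrow> real"
  assumes "summable (\<lambda>n. (x n)\<^sup>2)" "summable (\<lambda>n. (y n)\<^sup>2)"
  shows "summable (\<lambda>n. x n * y n)"
proof (rule summable_comparison_test')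
  show "summable (\<lambda>n. (x n)\<^sup>2 + (y n)\<^sup>2)"
    using assms by (rule summable_add)
  fix n :: nat
  have "0 \<le> (\<bar>x n\<bar> - \<bar>y n\<bar>)\<^sup>2"
    by simp
  then have "2 * (\<bar>x n\<bar> * \<bar>y n\<bar>) \<le> (x n)\<^sup>2 + (y n)\<^sup>2"
    by (simp add: power2_eq_square algebra_simps)
  moreover have "0 \<le> \<bar>x n\<bar> * \<bar>y n\<bar>"
    by simp
  ultimately show "norm (x n * y n) \<le> (x n)\<^sup>2 + (y n)\<^sup>2"
    unfolding real_norm_def abs_mult by linarith
qed

lemma summable_sq_add:
  fixes x y :: "nat \<Rightarrow> real"
  assumes "summable (\<lambda>n. (x n)\<^sup>2)" "summable (\<lambda>n. (y n)\<^sup>2)"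
  shows "summable (\<lambda>n. (x n + y n)\<^sup>2)"
proof -
  have "summable (\<lambda>n. (x n)\<^sup>2 + (y n)\<^sup>2 + 2 * (x n * y n))"
    by (intro summable_add summable_mult summable_mult_of_sq assms)
  then show ?thesis
    by (simp add: power2_eq_square algebra_simps)
qed

lemma summable_sq_scale:
  fixes x :: "nat \<Rightarrow> real"
  assumes "summable (\<lambda>n. (x n)\<^sup>2)"
  shows "summable (\<lambda>n. (c * x n)\<^sup>2)"
  by (simp add: power_mult_distrib summable_mult assms)

lemma l2_eqI: "(\<And>n. l2_nth x n = l2_nth y n) \<Longrightarrow> x = y"
  by (simp add: l2_nth_inject[symmetric] ext)

instantiation l2 :: real_vector
begin

lift_definition zero_l2 :: l2 is "\<lambda>_. 0" by simp
lift_definition plus_l2 :: "l2 \<Rightarrow> l2 \<Rightarrow> l2" is "\<lambda>x y n. x n + y n"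
  by (rule summable_sq_add)
lift_definition uminus_l2 :: "l2 \<Rightarrow> l2" is "\<lambda>x n. - x n" by simp
lift_definition minus_l2 :: "l2 \<Rightarrow> l2 \<Rightarrow> l2" is "\<lambda>x y n. x n - y n"
  using summable_sq_add[of _ "\<lambda>n. - y n" for y] by fastforce
lift_definition scaleR_l2 :: "real \<Rightarrow> l2 \<Rightarrow> l2" is "\<lambda>c x n. c * x n"
  by (rule summable_sq_scale)

instance
proof
  fix x y z :: l2 and a b :: real
  show "x + y + z = x + (y + z)" "x + y = y + x" "0 + x = x" "- x + x = 0" "x - y = x + - y"
    by (transfer, simp add: algebra_simps)+
  show "a *\<^sub>R (x + y) = a *\<^sub>R x + a *\<^sub>R y" "(a + b) *\<^sub>R x = a *\<^sub>R x + b *\<^sub>R x"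
    "a *\<^sub>R b *\<^sub>R x = (a * b) *\<^sub>R x" "1 *\<^sub>R x = x"
    by (transfer, simp add: algebra_simps)+
qed

end

instantiation l2 :: real_inner
begin

definition inner_l2 :: "l2 \<Rightarrow> l2 \<Rightarrow> real" where
  "inner_l2 x y = (\<Sum>n. l2_nth x n * l2_nth y n)"
definition norm_l2 :: "l2 \<Rightarrow> real" where
  "norm_l2 x = sqrt (inner x x)"
definition dist_l2 :: "l2 \<Rightarrow> l2 \<Rightarrow> real" where
  "dist_l2 x y = norm (x - y)"
definition sgn_l2 :: "l2 \<Rightarrow> l2" where
  "sgn_l2 x = x /\<^sub>R norm x"
definition uniformity_l2 :: "(l2 \<times> l2) filter" where
  "uniformity_l2 = (INF e\<in>{0<..}. principal {(x, y). dist x y < e})"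
definition open_l2 :: "l2 set \<Rightarrow> bool" where
  "open_l2 U \<longleftrightarrow> (\<forall>x\<in>U. eventually (\<lambda>(x', y). x' = x \<longrightarrow> y \<in> U) uniformity)"

instance
proof
  fix x y z :: l2 and a :: real
  have sm: "summable (\<lambda>n. l2_nth x n * l2_nth y n)" for x y
    by (intro summable_mult_of_sq l2_summable_sq)
  show "inner x y = inner y x"
    by (simp add: inner_l2_def mult.commute)
  show "inner (x + y) z = inner x z + inner y z"
    unfolding inner_l2_def suminf_add[OF sm sm]
    by (simp add: plus_l2.rep_eq algebra_simps)
  show "inner (a *\<^sub>R x) y = a * inner x y"
    unfolding inner_l2_def suminf_mult[OF sm, symmetric]
    by (simp add: scaleR_l2.rep_eq algebra_simps)
  show "0 \<le> inner x x"
    unfolding inner_l2_def by (intro suminf_nonneg sm) simp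
  show "inner x x = 0 \<longleftrightarrow> x = 0"
  proof
    assume eq0: "inner x x = 0"
    have "\<forall>n. l2_nth x n * l2_nth x n = 0"
      using suminf_eq_zero_iff[OF sm[of x x]] eq0 by (simp add: inner_l2_def)
    then show "x = 0"
      by (intro l2_eqI) (simp add: zero_l2.rep_eq)
  qed (simp add: inner_l2_def zero_l2.rep_eq)
  show "norm x = sqrt (inner x x)"
    by (rule norm_l2_def)
  show "dist x y = norm (x - y)"
    by (rule dist_l2_def)
  show "sgn x = x /\<^sub>R norm x"
    by (rule sgn_l2_def)
  show "uniformity = (INF e\<in>{0<..}. principal {(x :: l2, y). dist x y < e})"
    by (rule uniformity_l2_def)
  show "open U \<longleftrightarrow> (\<forall>x\<in>U. eventually (\<lambda>(x', y). x' = x \<longrightarrow> y \<in> U) uniformity)" for U :: "l2 set"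
    by (rule open_l2_def)
qed

end

lemma l2_norm_sq: "(norm (x :: l2))\<^sup>2 = (\<Sum>n. (l2_nth x n)\<^sup>2)"
  unfolding power2_norm_eq_inner inner_l2_def by (simp add: power2_eq_square)

lemma l2_partial_sum_le: "(\<Sum>n<N. (l2_nth x n)\<^sup>2) \<le> (norm x)\<^sup>2"
  unfolding l2_norm_sq by (intro sum_le_suminf l2_summable_sq) auto

lemma l2_nth_le_norm: "\<bar>l2_nth x n\<bar> \<le> norm x"
proof -
  have "(l2_nth x n)\<^sup>2 \<le> (\<Sum>n<Suc n. (l2_nth x n)\<^sup>2)"
    by (intro member_le_sum) auto
  also have "\<dots> \<le> (norm x)\<^sup>2"
    by (rule l2_partial_sum_le)
  finally show ?thesis
    by (simp add: abs_le_square_iff[symmetric])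
qed

lemma l2_norm_leI:
  assumes "\<And>N. (\<Sum>n<N. (l2_nth x n)\<^sup>2) \<le> e\<^sup>2" "0 \<le> e"
  shows "norm x \<le> e"
proof -
  have "(norm x)\<^sup>2 \<le> e\<^sup>2"
    unfolding l2_norm_sq by (intro suminf_le_const l2_summable_sq assms)
  then show ?thesis
    using \<open>0 \<le> e\<close> by (rule power2_le_imp_le)
qed

text \<open>Completeness and separability make the Bochner integral of \<^typ>\<open>l2\<close>-valued functions
  available.\<close>

instance l2 :: banach
proof
  fix X :: "nat \<Rightarrow> l2"
  assume X: "Cauchy X"
  have "Cauchy (\<lambda>m. l2_nth (X m) n)" for n
  proof (rule metric_CauchyI)
    fix e :: real assume "0 < e"
    then obtain N where N: "\<And>i j. i \<ge> N \<Longrightarrow> j \<ge> N \<Longrightarrow> dist (X i) (X j) < e"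
      using X by (meson Cauchy_def)
    have "dist (l2_nth (X i) n) (l2_nth (X j) n) < e" if "i \<ge> N" "j \<ge> N" for i j
      using l2_nth_le_norm[of "X i - X j" n] N[OF that]
      by (simp add: dist_norm minus_l2.rep_eq)
    then show "\<exists>N. \<forall>i\<ge>N. \<forall>j\<ge>N. dist (l2_nth (X i) n) (l2_nth (X j) n) < e"
      by blast
  qed
  then have "\<forall>n. \<exists>l. (\<lambda>m. l2_nth (X m) n) \<longlonglongrightarrow> l"
    by (simp add: Cauchy_convergent_iff convergent_def)
  then obtain a where a: "\<And>n. (\<lambda>m. l2_nth (X m) n) \<longlonglongrightarrow> a n"
    by metis
  have bound: "\<exists>N. \<forall>m\<ge>N. \<forall>K. (\<Sum>n<K. (l2_nth (X m) n - a n)\<^sup>2) \<le> e\<^sup>2" if "0 < e" for e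
  proof -
    obtain N where N: "\<And>i j. i \<ge> N \<Longrightarrow> j \<ge> N \<Longrightarrow> dist (X i) (X j) < e"
      using X \<open>0 < e\<close> by (meson Cauchy_def)
    have "(\<Sum>n<K. (l2_nth (X m) n - a n)\<^sup>2) \<le> e\<^sup>2" if "m \<ge> N" for m K
    proof (rule tendsto_upperbound)
      show "(\<lambda>j. \<Sum>n<K. (l2_nth (X m) n - l2_nth (X j) n)\<^sup>2) \<longlonglongrightarrow> (\<Sum>n<K. (l2_nth (X m) n - a n)\<^sup>2)"
        by (intro tendsto_intros a)
      have "(\<Sum>n<K. (l2_nth (X m) n - l2_nth (X j) n)\<^sup>2) \<le> e\<^sup>2" if "j \<ge> N" for j
      proof -
        have "(\<Sum>n<K. (l2_nth (X m) n - l2_nth (X j) n)\<^sup>2) \<le> (norm (X m - X j))\<^sup>2"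
          using l2_partial_sum_le[of "X m - X j" K] by (simp add: minus_l2.rep_eq)
        also have "\<dots> \<le> e\<^sup>2"
          using N[OF \<open>m \<ge> N\<close> that] by (intro power_mono) (auto simp: dist_norm)
        finally show ?thesis .
      qed
      then show "\<forall>\<^sub>F j in sequentially. (\<Sum>n<K. (l2_nth (X m) n - l2_nth (X j) n)\<^sup>2) \<le> e\<^sup>2"
        using eventually_sequentially by blast
    qed simp
    then show ?thesis by blast
  qed
  have summ: "summable (\<lambda>n. (a n)\<^sup>2)"
  proof -
    obtain m where m: "\<And>K. (\<Sum>n<K. (l2_nth (X m) n - a n)\<^sup>2) \<le> 1\<^sup>2"
      using bound[of 1] by auto
    have "summable (\<lambda>n. (l2_nth (X m) n - a n)\<^sup>2)"
      by (rule bounded_imp_summable[where B = 1])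
         (use m[of "Suc _"] in \<open>simp_all only: lessThan_Suc_atMost power_one zero_le_power2\<close>)
    then have "summable (\<lambda>n. (- 1 * (l2_nth (X m) n - a n))\<^sup>2)"
      by (rule summable_sq_scale)
    from summable_sq_add[OF l2_summable_sq[of "X m"] this] show ?thesis
      by simp
  qed
  define x where "x = Abs_l2 a"
  have x: "l2_nth x n = a n" for n
    unfolding x_def by (subst Abs_l2_inverse) (use summ in auto)
  have "X \<longlonglongrightarrow> x"
  proof (rule metric_LIMSEQ_I)
    fix r :: real assume "0 < r"
    then obtain N where N: "\<And>m K. m \<ge> N \<Longrightarrow> (\<Sum>n<K. (l2_nth (X m) n - a n)\<^sup>2) \<le> (r/2)\<^sup>2"
      using bound[of "r/2"] by auto
    have "dist (X m) x < r" if "m \<ge> N" for m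
    proof -
      have "norm (X m - x) \<le> r / 2"
        using N[OF that] \<open>0 < r\<close> by (intro l2_norm_leI) (auto simp: minus_l2.rep_eq x)
      then show ?thesis
        using \<open>0 < r\<close> by (simp add: dist_norm)
    qed
    then show "\<exists>N. \<forall>m\<ge>N. dist (X m) x < r" by blast
  qed
  then show "convergent X"
    by (auto simp: convergent_def)
qed

lift_definition l2_of_rats :: "rat list \<Rightarrow> l2" is
  "\<lambda>xs n. if n < length xs then of_rat (xs ! n) else 0"
  by (rule summable_finite[of "{..<length xs}" for xs]) auto

lemma l2_rats_dense:
  fixes x :: l2
  assumes "0 < e"
  shows "\<exists>q. norm (x - l2_of_rats q) < e"
proof -
  define d where "d = e\<^sup>2 / 3"
  have "0 < d" using assms by (simp add: d_def)
  obtain N where N: "(\<Sum>n. (l2_nth x (n + N))\<^sup>2) < d"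
    using suminf_exist_split[OF \<open>0 < d\<close> l2_summable_sq[of x]]
    by (metis abs_ge_self le_less_trans order_refl real_norm_def)
  define s where "s = sqrt (d / (N + 1))"
  have "0 < s" using \<open>0 < d\<close> by (simp add: s_def)
  have "\<exists>r. \<bar>l2_nth x n - of_rat r\<bar> < s" for n
  proof -
    obtain r where "l2_nth x n - s < of_rat r" "of_rat r < l2_nth x n"
      using of_rat_dense[of "l2_nth x n - s" "l2_nth x n"] \<open>0 < s\<close> by auto
    then show ?thesis by (intro exI[of _ r]) auto
  qed
  then obtain r where r: "\<And>n. \<bar>l2_nth x n - of_rat (r n)\<bar> < s"
    by metis
  define y where "y = l2_of_rats (map r [0..<N])"
  have y: "l2_nth y n = (if n < N then of_rat (r n) else 0)" for n
    by (simp add: y_def l2_of_rats.rep_eq)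
  have "(norm (x - y))\<^sup>2 = (\<Sum>n. (l2_nth (x - y) (n + N))\<^sup>2) + (\<Sum>n<N. (l2_nth (x - y) n)\<^sup>2)"
    unfolding l2_norm_sq by (intro suminf_split_initial_segment l2_summable_sq)
  also have "(\<Sum>n. (l2_nth (x - y) (n + N))\<^sup>2) = (\<Sum>n. (l2_nth x (n + N))\<^sup>2)"
    by (simp add: minus_l2.rep_eq y)
  also have "(\<Sum>n<N. (l2_nth (x - y) n)\<^sup>2) \<le> (\<Sum>n<N. s\<^sup>2)"
  proof (rule sum_mono)
    fix n assume "n \<in> {..<N}"
    then show "(l2_nth (x - y) n)\<^sup>2 \<le> s\<^sup>2"
      using r[of n] \<open>0 < s\<close> by (simp add: minus_l2.rep_eq y abs_le_square_iff[symmetric])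
  qed
  also have "(\<Sum>n<N. s\<^sup>2) \<le> d"
    using \<open>0 < d\<close> by (simp add: s_def field_simps)
  finally have "(norm (x - y))\<^sup>2 < 3 * d"
    using N \<open>0 < d\<close> by simp
  then have "(norm (x - y))\<^sup>2 < e\<^sup>2"
    by (simp add: d_def)
  then show ?thesis
    using assms unfolding y_def by (metis less_imp_le power2_less_imp_less)
qed

instance l2 :: second_countable_topology
proof
  define B where "B = (\<lambda>(q, k). ball (l2_of_rats q) (1 / real (Suc k))) ` UNIV"
  have "countable B"
    unfolding B_def by simp
  moreover have "topological_basis B"
  proof (rule topological_basisI)
    fix U :: "l2 set" and x
    assume "open U" "x \<in> U"
    then obtain e where "e > 0" and e: "ball x e \<subseteq> U"
      by (auto simp: open_contains_ball)
    obtain k where k: "1 / real (Suc k) < e / 2"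
      using nat_approx_posE[of "e/2"] \<open>e > 0\<close> by auto
    obtain q where q: "norm (x - l2_of_rats q) < 1 / real (Suc k)"
      using l2_rats_dense[of "1 / real (Suc k)" x] by auto
    let ?b = "ball (l2_of_rats q) (1 / real (Suc k))"
    have "x \<in> ?b"
      using q by (simp add: dist_norm norm_minus_commute)
    moreover have "?b \<subseteq> ball x e"
    proof
      fix z assume "z \<in> ?b"
      then have "dist x z < 1 / real (Suc k) + 1 / real (Suc k)"
        using q dist_triangle[of x z "l2_of_rats q"] by (simp add: dist_norm)
      then show "z \<in> ball x e" using k by simp
    qed
    ultimately show "\<exists>b\<in>B. x \<in> b \<and> b \<subseteq> U"
      using e by (auto simp: B_def)
  qed (auto simp: B_def)
  ultimately show "\<exists>B :: l2 set set. countable B \<and> open = generate_topology B"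
    using topological_basis_imp_subbasis by blast
qed

section \<open>Differentiability of finite order\<close>

text \<open>Since the domain is finite-dimensional, iterated directional derivatives suffice, also for
  maps into an infinite-dimensional space.\<close>

primrec Ck_on :: "nat \<Rightarrow> 'e::euclidean_space set \<Rightarrow> ('e \<Rightarrow> 'b::real_normed_vector) \<Rightarrow> bool" where
  "Ck_on 0 S f \<longleftrightarrow> continuous_on S f"
| "Ck_on (Suc k) S f \<longleftrightarrow> (\<forall>x\<in>S. f differentiable at x) \<and>
     (\<forall>v. Ck_on k S (\<lambda>x. frechet_derivative f (at x) v))"

definition smooth_on :: "'e::euclidean_space set \<Rightarrow> ('e \<Rightarrow> 'b::real_normed_vector) \<Rightarrow> bool" where
  "smooth_on S f \<longleftrightarrow> (\<forall>k. Ck_on k S f)"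

section \<open>Compact manifolds\<close>

text \<open>The underlying space of the manifold is the whole type \<open>'a\<close>. A chart is a pair of its domain
  and a coordinate map, whose values outside the domain are irrelevant; the dimension is
  \<open>CARD('n)\<close>.\<close>

type_synonym ('a, 'n) chart = "'a set \<times> ('a \<Rightarrow> real ^ 'n)"

abbreviation chart_dom :: "('a, 'n) chart \<Rightarrow> 'a set" where
  "chart_dom c \<equiv> fst c"

definition chart_ran :: "('a, 'n) chart \<Rightarrow> (real ^ 'n) set" where
  "chart_ran c = snd c ` chart_dom c"

definition in_chart :: "('a, 'n) chart \<Rightarrow> ('a \<Rightarrow> 'b) \<Rightarrow> real ^ 'n \<Rightarrow> 'b" where
  "in_chart c f = f \<circ> inv_into (chart_dom c) (snd c)"

definition smooth_atlas ::
    "('a::{t2_space, second_countable_topology}, 'n::finite) chart set \<Rightarrow> bool" where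
  "smooth_atlas A \<longleftrightarrow>
     (\<Union>c\<in>A. chart_dom c) = UNIV \<and>
     (\<forall>c\<in>A. open (chart_dom c) \<and> open (chart_ran c) \<and>
        homeomorphism (chart_dom c) (chart_ran c) (snd c) (inv_into (chart_dom c) (snd c))) \<and>
     (\<forall>c\<in>A. \<forall>c'\<in>A. smooth_on (snd c ` (chart_dom c \<inter> chart_dom c')) (in_chart c (snd c')))"

definition compact_manifold ::
    "('a::{t2_space, second_countable_topology}, 'n::finite) chart set \<Rightarrow> bool" where
  "compact_manifold A \<longleftrightarrow>
     smooth_atlas A \<and> compact (UNIV :: 'a set) \<and> connected (UNIV :: 'a set)"

definition Ck_map ::
    "nat \<Rightarrow> ('a, 'n::finite) chart set \<Rightarrow> ('a \<Rightarrow> 'b::real_normed_vector) \<Rightarrow> bool" where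
  "Ck_map k A f \<longleftrightarrow> (\<forall>c\<in>A. Ck_on k (chart_ran c) (in_chart c f))"

definition smooth_map ::
    "('a, 'n::finite) chart set \<Rightarrow> ('a \<Rightarrow> 'b::real_normed_vector) \<Rightarrow> bool" where
  "smooth_map A f \<longleftrightarrow> (\<forall>c\<in>A. smooth_on (chart_ran c) (in_chart c f))"

text \<open>The \<open>i\<close>-th partial derivative in the coordinates of a chart, as a function on the
  manifold.\<close>

definition chart_partial ::
    "('a, 'n::finite) chart \<Rightarrow> 'n \<Rightarrow> ('a \<Rightarrow> 'b::real_normed_vector) \<Rightarrow> 'a \<Rightarrow> 'b" where
  "chart_partial c i f p = frechet_derivative (in_chart c f) (at (snd c p)) (axis i 1)"

text \<open>A smooth volume element is a positive smooth density, given by its Borel measure.\<close>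

definition smooth_volume ::
    "('a::topological_space, 'n::finite) chart set \<Rightarrow> 'a measure \<Rightarrow> bool" where
  "smooth_volume A \<mu> \<longleftrightarrow> sets \<mu> = sets borel \<and>
     (\<forall>c\<in>A. \<exists>\<rho> :: real ^ 'n \<Rightarrow> real. smooth_on (chart_ran c) \<rho> \<and> (\<forall>x\<in>chart_ran c. \<rho> x > 0) \<and>
        (\<forall>B\<in>sets borel. B \<subseteq> chart_dom c \<longrightarrow>
           emeasure \<mu> B = (\<integral>\<^sup>+x. ennreal (\<rho> x) * indicator (snd c ` B) x \<partial>lborel)))"

definition normalized :: "'a measure \<Rightarrow> 'a measure" where
  "normalized \<mu> = uniform_measure \<mu> (space \<mu>)"

section \<open>Tensor fields of order two\<close>

text \<open>A tensor field is the family of its coefficient matrices at the points of the charts, subject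
  to the transformation law. Values at points outside the domain of a chart, or for charts outside
  the atlas, carry no information.\<close>

type_synonym ('a, 'n) tensor2 = "('a, 'n) chart \<Rightarrow> 'a \<Rightarrow> real ^ 'n ^ 'n"

definition transition_jacobian ::
    "('a, 'n::finite) chart \<Rightarrow> ('a, 'n) chart \<Rightarrow> 'a \<Rightarrow> real ^ 'n ^ 'n" where
  "transition_jacobian c c' p = jacobian (in_chart c (snd c')) (at (snd c p))"

text \<open>Smooth sections of \<open>S\<^sup>2 T\<^sup>*M\<close> and of \<open>S\<^sup>2 TM\<close>.\<close>

definition sym_cov2 :: "('a, 'n::finite) chart set \<Rightarrow> ('a, 'n) tensor2 \<Rightarrow> bool" where
  "sym_cov2 A k \<longleftrightarrow>
     (\<forall>c\<in>A. smooth_on (chart_ran c) (in_chart c (k c))) \<and>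
     (\<forall>c\<in>A. \<forall>p\<in>chart_dom c. transpose (k c p) = k c p) \<and>
     (\<forall>c\<in>A. \<forall>c'\<in>A. \<forall>p\<in>chart_dom c \<inter> chart_dom c'. k c p =
        transpose (transition_jacobian c c' p) ** k c' p ** transition_jacobian c c' p)"

definition sym_contra2 :: "('a, 'n::finite) chart set \<Rightarrow> ('a, 'n) tensor2 \<Rightarrow> bool" where
  "sym_contra2 A g \<longleftrightarrow>
     (\<forall>c\<in>A. smooth_on (chart_ran c) (in_chart c (g c))) \<and>
     (\<forall>c\<in>A. \<forall>p\<in>chart_dom c. transpose (g c p) = g c p) \<and>
     (\<forall>c\<in>A. \<forall>c'\<in>A. \<forall>p\<in>chart_dom c \<inter> chart_dom c'. g c' p =
        transition_jacobian c c' p ** g c p ** transpose (transition_jacobian c c' p))"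

text \<open>For a covariant field \<open>v\<close> below is a vector, for a contravariant one it is a covector.\<close>

definition pos_def :: "('a, 'n::finite) chart set \<Rightarrow> ('a, 'n) tensor2 \<Rightarrow> bool" where
  "pos_def A t \<longleftrightarrow> (\<forall>c\<in>A. \<forall>p\<in>chart_dom c. \<forall>v. v \<noteq> 0 \<longrightarrow> v \<bullet> (t c p *v v) > 0)"

definition tensor_le ::
    "('a, 'n::finite) chart set \<Rightarrow> ('a, 'n) tensor2 \<Rightarrow> ('a, 'n) tensor2 \<Rightarrow> bool" where
  "tensor_le A k h \<longleftrightarrow> (\<forall>c\<in>A. \<forall>p\<in>chart_dom c. \<forall>v. v \<bullet> (k c p *v v) \<le> v \<bullet> (h c p *v v))"

definition tensor_eq ::
    "('a, 'n::finite) chart set \<Rightarrow> ('a, 'n) tensor2 \<Rightarrow> ('a, 'n) tensor2 \<Rightarrow> bool" where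
  "tensor_eq A k h \<longleftrightarrow> (\<forall>c\<in>A. \<forall>p\<in>chart_dom c. k c p = h c p)"

definition riemannian_metric :: "('a, 'n::finite) chart set \<Rightarrow> ('a, 'n) tensor2 \<Rightarrow> bool" where
  "riemannian_metric A h \<longleftrightarrow> sym_cov2 A h \<and> pos_def A h"

definition Mstar :: "('a, 'n::finite) chart set \<Rightarrow> ('a, 'n) tensor2 set" where
  "Mstar A = {g. sym_contra2 A g \<and> (\<forall>c\<in>A. \<forall>p\<in>chart_dom c. \<forall>\<xi>. \<xi> \<bullet> (g c p *v \<xi>) \<ge> 0)}"

definition nonzero_tensor :: "('a, 'n::finite) chart set \<Rightarrow> ('a, 'n) tensor2 \<Rightarrow> bool" where
  "nonzero_tensor A g \<longleftrightarrow> \<not> tensor_eq A g (\<lambda>_ _. 0)"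

text \<open>By the transformation laws, the contractions below do not depend on the chart.\<close>

definition chart_at :: "('a, 'n) chart set \<Rightarrow> 'a \<Rightarrow> ('a, 'n) chart" where
  "chart_at A p = (SOME c. c \<in> A \<and> p \<in> chart_dom c)"

definition pairing ::
    "('a, 'n::finite) chart set \<Rightarrow> ('a, 'n) tensor2 \<Rightarrow> ('a, 'n) tensor2 \<Rightarrow> 'a \<Rightarrow> real" where
  "pairing A g k p = (let c = chart_at A p in \<Sum>i\<in>UNIV. \<Sum>j\<in>UNIV. g c p $ i $ j * k c p $ i $ j)"

definition cometric_d ::
    "('a, 'n::finite) chart set \<Rightarrow> ('a, 'n) tensor2 \<Rightarrow> ('a \<Rightarrow> real) \<Rightarrow> ('a \<Rightarrow> real) \<Rightarrow> 'a \<Rightarrow> real"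
  where "cometric_d A g u v p = (let c = chart_at A p in
     \<Sum>i\<in>UNIV. \<Sum>j\<in>UNIV. g c p $ i $ j * chart_partial c i u p * chart_partial c j v p)"

text \<open>The pullback of the standard metric of an inner product space.\<close>

definition pullback_metric :: "('a \<Rightarrow> 'b::real_inner) \<Rightarrow> ('a, 'n::finite) tensor2" where
  "pullback_metric \<phi> c p = (\<chi> i j. chart_partial c i \<phi> p \<bullet> chart_partial c j \<phi> p)"

section \<open>Rayleigh quotient and Bakry-Emery Laplacian\<close>

definition rayleigh ::
    "('a, 'n::finite) chart set \<Rightarrow> 'a measure \<Rightarrow> ('a, 'n) tensor2 \<Rightarrow> ('a \<Rightarrow> real) \<Rightarrow> real" where
  "rayleigh A \<mu> g u = (\<integral>p. cometric_d A g u u p \<partial>\<mu>) / (\<integral>p. (u p)\<^sup>2 \<partial>\<mu>)"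

definition test_functions ::
    "('a, 'n::finite) chart set \<Rightarrow> 'a measure \<Rightarrow> ('a \<Rightarrow> real) set" where
  "test_functions A \<mu> = {u. Ck_map 1 A u \<and> u \<noteq> (\<lambda>_. 0) \<and> (\<integral>p. u p \<partial>\<mu>) = 0}"

text \<open>For \<open>g \<in> Mstar A\<close> all Rayleigh quotients are nonnegative, so nothing is truncated by
  \<^const>\<open>ennreal\<close>.\<close>

definition lambda1 ::
    "('a, 'n::finite) chart set \<Rightarrow> 'a measure \<Rightarrow> ('a, 'n) tensor2 \<Rightarrow> ennreal" where
  "lambda1 A \<mu> g = (INF u\<in>test_functions A \<mu>. ennreal (rayleigh A \<mu> g u))"

definition rayleigh_minimizer ::
    "('a, 'n::finite) chart set \<Rightarrow> 'a measure \<Rightarrow> ('a, 'n) tensor2 \<Rightarrow> ('a \<Rightarrow> real) \<Rightarrow> bool" where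
  "rayleigh_minimizer A \<mu> g u \<longleftrightarrow> u \<in> test_functions A \<mu> \<and>
     (\<forall>v\<in>test_functions A \<mu>. rayleigh A \<mu> g u \<le> rayleigh A \<mu> g v)"

text \<open>\<open>f\<close> is the Bakry-Emery Laplacian of \<open>u\<close>; this determines \<open>f\<close> uniquely.\<close>

definition has_BE_laplacian ::
    "('a, 'n::finite) chart set \<Rightarrow> 'a measure \<Rightarrow> ('a, 'n) tensor2 \<Rightarrow> ('a \<Rightarrow> real) \<Rightarrow> ('a \<Rightarrow> real) \<Rightarrow> bool"
  where "has_BE_laplacian A \<mu> g u f \<longleftrightarrow> smooth_map A u \<and> smooth_map A f \<and>
     (\<forall>v. smooth_map A v \<longrightarrow> (\<integral>p. f p * v p \<partial>\<mu>) = - (\<integral>p. cometric_d A g u v p \<partial>\<mu>))"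

text \<open>Eigenspaces and eigenvalues of the negative Laplacian; the eigenspace contains the zero
  function.\<close>

definition eigenspace ::
    "('a, 'n::finite) chart set \<Rightarrow> 'a measure \<Rightarrow> ('a, 'n) tensor2 \<Rightarrow> real \<Rightarrow> ('a \<Rightarrow> real) set" where
  "eigenspace A \<mu> g l = {u. has_BE_laplacian A \<mu> g u (\<lambda>p. - (l * u p))}"

definition eigenvalue ::
    "('a, 'n::finite) chart set \<Rightarrow> 'a measure \<Rightarrow> ('a, 'n) tensor2 \<Rightarrow> real \<Rightarrow> bool" where
  "eigenvalue A \<mu> g l \<longleftrightarrow> (\<exists>u\<in>eigenspace A \<mu> g l. u \<noteq> (\<lambda>_. 0))"

definition first_eigenfunction ::
    "('a, 'n::finite) chart set \<Rightarrow> 'a measure \<Rightarrow> ('a, 'n) tensor2 \<Rightarrow> ('a \<Rightarrow> real) \<Rightarrow> bool" where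
  "first_eigenfunction A \<mu> g u \<longleftrightarrow> (\<exists>l>0. eigenvalue A \<mu> g l \<and>
     (\<forall>l'>0. eigenvalue A \<mu> g l' \<longrightarrow> l \<le> l') \<and> u \<in> eigenspace A \<mu> g l)"

section \<open>Maps into l2 and the two dual quantities\<close>

definition consists_of :: "(('a \<Rightarrow> real) \<Rightarrow> bool) \<Rightarrow> ('a \<Rightarrow> l2) \<Rightarrow> bool" where
  "consists_of P \<phi> \<longleftrightarrow> (\<forall>k. P (\<lambda>p. l2_nth (\<phi> p) k) \<or> (\<forall>p. l2_nth (\<phi> p) k = 0))"

text \<open>The integral of \<open>\<phi>\<close> is the Bochner integral in \<^typ>\<open>l2\<close>.\<close>

definition feasible_map ::
    "('a, 'n::finite) chart set \<Rightarrow> 'a measure \<Rightarrow> ('a, 'n) tensor2 \<Rightarrow> ('a \<Rightarrow> l2) \<Rightarrow> bool" where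
  "feasible_map A \<mu> h \<phi> \<longleftrightarrow> smooth_map A \<phi> \<and> (\<integral>p. \<phi> p \<partial>normalized \<mu>) = 0 \<and>
     tensor_le A (pullback_metric \<phi>) h"

definition Var :: "('a, 'n::finite) chart set \<Rightarrow> 'a measure \<Rightarrow> ('a, 'n) tensor2 \<Rightarrow> ennreal" where
  "Var A \<mu> h = (SUP \<phi>\<in>Collect (feasible_map A \<mu> h). ennreal (\<integral>p. (norm (\<phi> p))\<^sup>2 \<partial>normalized \<mu>))"

definition Lambda1 ::
    "('a, 'n::finite) chart set \<Rightarrow> 'a measure \<Rightarrow> ('a, 'n) tensor2 \<Rightarrow> ennreal" where
  "Lambda1 A \<mu> h = (SUP g\<in>{g \<in> Mstar A. nonzero_tensor A g}.
     lambda1 A \<mu> g / ennreal (\<integral>p. pairing A g h p \<partial>normalized \<mu>))"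

definition dual_bound ::
    "('a, 'n::finite) chart set \<Rightarrow> 'a measure \<Rightarrow> ('a, 'n) tensor2 \<Rightarrow> ('a, 'n) tensor2 \<Rightarrow> ennreal" where
  "dual_bound A \<mu> h g = (if lambda1 A \<mu> g = 0 then \<infinity>
     else ennreal (\<integral>p. pairing A g h p \<partial>normalized \<mu>) / lambda1 A \<mu> g)"

end

theory Submission
  imports Defs
begin

text \<open>
  Write \<open>u\<^sub>k\<close> for the components of \<open>\<phi>\<close>, let \<open>E(u)\<close> be the integral of \<open>g\<^sup>*(du, du)\<close>, and let \<open>l\<close> be the
  first eigenvalue. Expanding in the coordinates of \<open>l\<^sup>2\<close> gives \<open>\<parallel>\<phi>\<parallel>\<^sup>2 = \<Sum>\<^sub>k u\<^sub>k\<^sup>2\<close> and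
  \<open>(g\<^sup>*, \<phi>\<^sup>*h\<^sub>l\<^sub>2) = \<Sum>\<^sub>k g\<^sup>*(du\<^sub>k, du\<^sub>k)\<close> at every point, and both sums may be integrated term by term
  (\<open>norm_square_sums\<close>, \<open>energy_sums\<close>). Hence

  \<open>\<integral> (g\<^sup>*, h) - l \<integral> \<parallel>\<phi>\<parallel>\<^sup>2 = \<integral> (g\<^sup>*, h - \<phi>\<^sup>*h\<^sub>l\<^sub>2) + \<Sum>\<^sub>k (E(u\<^sub>k) - l \<integral> u\<^sub>k\<^sup>2)\<close>.

  Every term on the right is nonnegative. The first integrand is the trace of a product of two positive
  semidefinite matrices, and each summand is nonnegative by the definition of \<open>l\<close>, because \<open>u\<^sub>k\<close> has
  mean value zero. This is the inequality (\<open>variance_le\<close>). Equality means that all terms vanish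
  (\<open>variance_eq_iff\<close>). The first one vanishes iff its integrand does, since that is continuous and
  nonempty open sets have positive volume. A summand vanishes iff \<open>u\<^sub>k\<close> is zero or minimizes the Rayleigh
  quotient (\<open>minimizer_iff\<close>). If \<open>l = 0\<close>, then the two conditions would force \<open>\<integral> (g\<^sup>*, h) = 0\<close>, which is
  impossible for nonzero \<open>g\<^sup>*\<close> (\<open>integral_pairing_metric_pos\<close>); this agrees with the infinite bound.

  For positive definite \<open>g\<^sup>*\<close> the vanishing trace \<open>(g\<^sup>*, h - \<phi>\<^sup>*h\<^sub>l\<^sub>2)\<close> forces \<open>\<phi>\<^sup>*h\<^sub>l\<^sub>2 = h\<close>. A minimizer satisfies
  \<open>\<integral> g\<^sup>*(du, dv) = l \<integral> u v\<close> for all \<open>v\<close>, by the first variation of the Rayleigh quotient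
  (\<open>minimizer_weak_equation\<close>); as the components of \<open>\<phi>\<close> are smooth, this is the eigenvalue equation. Here
  \<open>l\<close> is positive, because a function of zero energy is constant on the connected manifold
  (\<open>rayleigh_pos\<close>), and no positive eigenvalue is smaller, because eigenfunctions of positive eigenvalues
  have mean value zero.

  The bound on \<open>Var\<close> follows by multiplying out: \<open>\<integral> \<parallel>\<phi>\<parallel>\<^sup>2 d\<mu>\<^sub>1\<close> times any quotient in the definition
  of \<open>\<Lambda>\<^sub>1\<close> is at most one, and multiplication by a constant commutes with the supremum.

  Two facts about the manifold enter besides calculus in charts. Contractions of tensors do not depend on
  the chart, hence are continuous (\<open>pairing_in_chart\<close>, \<open>continuous_pairing\<close>). There is a nonconstant
  continuously differentiable function (\<open>exists_nonconstant_C1\<close>), so that \<open>l\<close> is finite; with an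
  infinite \<open>l\<close> the bound would be zero and the zero map would attain it for every \<open>g\<^sup>*\<close>.
\<close>

section \<open>Contraction of positive semidefinite matrices\<close>

definition contraction :: "real^'n^'n \<Rightarrow> real^'n^'n \<Rightarrow> real" where
  "contraction G K = (\<Sum>i\<in>UNIV. \<Sum>j\<in>UNIV. G $ i $ j * K $ i $ j)"

definition psd :: "real^'n^'n \<Rightarrow> bool" where
  "psd G \<longleftrightarrow> transpose G = G \<and> (\<forall>x. 0 \<le> x \<bullet> (G *v x))"

lemma contraction_commute: "contraction G K = contraction K G"
  by (simp add: contraction_def mult.commute)

lemma contraction_add_left: "contraction (G + G') K = contraction G K + contraction G' K"
  by (simp add: contraction_def sum.distrib algebra_simps)

lemma contraction_diff_right: "contraction G (K - K') = contraction G K - contraction G K'"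
  by (simp add: contraction_def sum_subtractf algebra_simps)

lemma contraction_scaleR_left: "contraction (a *\<^sub>R G) K = a * contraction G K"
  by (simp add: contraction_def sum_distrib_left mult.assoc)

lemma quadratic_form_sum: "x \<bullet> (K *v y) = (\<Sum>i\<in>UNIV. \<Sum>j\<in>UNIV. x $ i * y $ j * K $ i $ j)"
  for x y :: "real^'n"
  by (simp add: inner_vec_def matrix_vector_mult_def sum_distrib_left mult_ac)

lemma contraction_rank_one: "contraction (\<chi> i j. w $ i * w $ j) K = w \<bullet> (K *v w)"
  by (simp add: contraction_def quadratic_form_sum)

lemma contraction_self_eq_0: "contraction G G = 0 \<Longrightarrow> G = 0"
  by (auto simp: contraction_def sum_nonneg_eq_0_iff sum_nonneg vec_eq_iff)

lemma contraction_trace: "contraction G K = trace (G ** transpose K)"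
  by (simp add: contraction_def trace_def matrix_matrix_mult_def transpose_def)

text \<open>This is what makes contractions independent of the chart: \<open>J\<close> will be the Jacobian of a chart
  transition.\<close>

lemma contraction_congruence:
  "contraction (J ** G ** transpose J) K = contraction G (transpose J ** K ** J)"
proof -
  have "trace (J ** G ** transpose J ** transpose K) = trace (J ** (G ** transpose J ** transpose K))"
    by (simp add: matrix_mul_assoc)
  also have "\<dots> = trace (G ** transpose J ** transpose K ** J)"
    by (rule trace_mul_sym)
  finally show ?thesis
    by (simp add: contraction_trace matrix_transpose_mul matrix_mul_assoc)
qed

lemma psd_symmetric: "psd G \<Longrightarrow> G $ i $ j = G $ j $ i"
  by (auto simp: psd_def vec_eq_iff transpose_def)

text \<open>The Cauchy--Schwarz inequality of a semidefinite form: \<open>t \<mapsto> (x + t y) \<bullet> G (x + t y)\<close> is a nonnegative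
  quadratic polynomial. If its leading coefficient vanishes, it is affine and so constant; otherwise its
  value at the vertex gives the bound.\<close>

lemma psd_cross: assumes "psd G" shows "(x \<bullet> (G *v y))\<^sup>2 \<le> (x \<bullet> (G *v x)) * (y \<bullet> (G *v y))"
proof -
  have sym: "y \<bullet> (G *v x) = x \<bullet> (G *v y)"
  proof -
    have "y \<bullet> (G *v x) = (transpose G *v y) \<bullet> x"
      by (simp add: dot_lmul_matrix transpose_matrix_vector)
    also have "\<dots> = x \<bullet> (G *v y)"
      using assms by (simp add: psd_def inner_commute)
    finally show ?thesis .
  qed
  have *: "0 \<le> x \<bullet> (G *v x) + 2 * t * (x \<bullet> (G *v y)) + t\<^sup>2 * (y \<bullet> (G *v y))" for t
  proof -
    have "0 \<le> (x + t *\<^sub>R y) \<bullet> (G *v (x + t *\<^sub>R y))"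
      using assms by (simp add: psd_def)
    then show ?thesis
      by (simp add: matrix_vector_right_distrib inner_simps matrix_vector_mult_scaleR
          sym power2_eq_square algebra_simps)
  qed
  have nn: "0 \<le> y \<bullet> (G *v y)" using assms by (simp add: psd_def)
  show ?thesis
  proof (cases "y \<bullet> (G *v y) = 0")
    case True
    have "x \<bullet> (G *v y) = 0"
    proof (rule ccontr)
      assume n: "x \<bullet> (G *v y) \<noteq> 0"
      \<comment> \<open>at this parameter the affine polynomial would take the value \<open>-1\<close>\<close>
      have "2 * (- (x \<bullet> (G *v x) + 1) / (2 * (x \<bullet> (G *v y)))) * (x \<bullet> (G *v y)) = - (x \<bullet> (G *v x) + 1)"
        using n by simp
      with *[of "- (x \<bullet> (G *v x) + 1) / (2 * (x \<bullet> (G *v y)))"] True show False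
        by simp
    qed
    with True show ?thesis by simp
  next
    case False
    with nn have pos: "0 < y \<bullet> (G *v y)" by simp
    from *[of "- (x \<bullet> (G *v y)) / (y \<bullet> (G *v y))"] pos
    show ?thesis
      by (simp add: field_simps power2_eq_square)
  qed
qed

lemma quadratic_form_axis: "axis i 1 \<bullet> (G *v axis j 1) = G $ i $ j" for G :: "real^'n^'n"
  by (simp add: inner_axis' matrix_vector_mult_basis column_def)

text \<open>One elimination step of the Cholesky algorithm: if \<open>G\<^sub>i\<^sub>i \<noteq> 0\<close>, subtract from \<open>G\<close> the rank-one matrix
  \<open>w w\<^sup>T / G\<^sub>i\<^sub>i\<close> with \<open>w = G e\<^sub>i\<close>. By Cauchy--Schwarz the remainder is again positive semidefinite; its
  \<open>i\<close>-th diagonal entry vanishes and the diagonal entries that were zero remain so. A semidefinite matrix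
  with zero diagonal is zero. Stating the decomposition \<open>G = \<Sum> w w\<^sup>T\<close> through contractions turns the trace
  of a product \<open>G K\<close> into a sum of values of the quadratic form of \<open>K\<close>.\<close>

lemma psd_rank_one_decomposition:
  assumes "psd (G :: real^'n^'n)"
  shows "\<exists>ws. \<forall>K. contraction G K = (\<Sum>w\<leftarrow>ws. w \<bullet> (K *v w))"
  using assms
proof (induction "card {i. G $ i $ i \<noteq> 0}" arbitrary: G rule: less_induct)
  case less
  show ?case
  proof (cases "\<exists>i. G $ i $ i \<noteq> 0")
    case False
    have "G $ i $ j = 0" for i j
      using psd_cross[OF less.prems, of "axis i 1" "axis j 1"] False
      by (simp add: quadratic_form_axis)
    then have "contraction G K = 0" for K
      by (simp add: contraction_def)
    then show ?thesis by (intro exI[of _ "[]"]) simp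
  next
    case True
    then obtain i where i: "G $ i $ i \<noteq> 0" by auto
    have "0 \<le> axis i 1 \<bullet> (G *v axis i 1)" using less.prems by (simp add: psd_def)
    with i have gi: "0 < G $ i $ i" by (simp add: quadratic_form_axis)
    define w where "w = G *v axis i 1"
    have w: "w $ j = G $ j $ i" for j
      by (simp add: w_def matrix_vector_mult_basis column_def)
    define W where "W = (\<chi> j k. w $ j * w $ k)"
    define G' where "G' = G - (1 / G $ i $ i) *\<^sub>R W"
    have G'e: "G' $ j $ k = G $ j $ k - G $ j $ i * G $ k $ i / G $ i $ i" for j k
      by (simp add: G'_def W_def w)
    have quad: "x \<bullet> (G' *v x) = x \<bullet> (G *v x) - (x \<bullet> w)\<^sup>2 / G $ i $ i" for x
    proof -
      have "x \<bullet> (W *v x) = (x \<bullet> w)\<^sup>2"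
        unfolding quadratic_form_sum
        by (simp add: W_def power2_eq_square inner_vec_def sum_product mult_ac)
      then show ?thesis
        by (simp add: G'_def matrix_vector_mult_diff_rdistrib inner_diff_right
            scaleR_matrix_vector_assoc[symmetric])
    qed
    have "psd G'"
      unfolding psd_def
    proof (intro conjI allI)
      show "transpose G' = G'"
        using psd_symmetric[OF less.prems] by (simp add: vec_eq_iff transpose_def G'e mult.commute)
      show "0 \<le> x \<bullet> (G' *v x)" for x
        using psd_cross[OF less.prems, of x "axis i 1"] gi
        by (simp add: quad quadratic_form_axis w_def[symmetric] inner_axis' w field_simps)
    qed
    moreover have "card {j. G' $ j $ j \<noteq> 0} < card {j. G $ j $ j \<noteq> 0}"
    proof (rule psubset_card_mono)
      have "G' $ j $ j = 0" if "G $ j $ j = 0" for j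
        using psd_cross[OF less.prems, of "axis j 1" "axis i 1"] that
        by (simp add: quadratic_form_axis G'e)
      moreover have "G' $ i $ i = 0" using gi by (simp add: G'e)
      ultimately show "{j. G' $ j $ j \<noteq> 0} \<subset> {j. G $ j $ j \<noteq> 0}"
        using i by auto
    qed simp
    ultimately obtain ws where ws: "\<And>K. contraction G' K = (\<Sum>w\<leftarrow>ws. w \<bullet> (K *v w))"
      using less.hyps by blast
    define v where "v = (1 / sqrt (G $ i $ i)) *\<^sub>R w"
    have "contraction G K = v \<bullet> (K *v v) + contraction G' K" for K
    proof -
      have "contraction G K = contraction G' K + (1 / G $ i $ i) * (w \<bullet> (K *v w))"
        using contraction_add_left[of G' "(1 / G $ i $ i) *\<^sub>R W" K]
        by (simp add: G'_def contraction_scaleR_left W_def contraction_rank_one)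
      also have "(1 / G $ i $ i) * (w \<bullet> (K *v w)) = v \<bullet> (K *v v)"
        using gi by (simp add: v_def matrix_vector_mult_scaleR field_simps)
      finally show ?thesis by simp
    qed
    then show ?thesis
      by (intro exI[of _ "v # ws"]) (simp add: ws)
  qed
qed

lemma contraction_psd_nonneg:
  assumes "psd G" "\<And>x. 0 \<le> x \<bullet> (K *v x)"
  shows "0 \<le> contraction G K"
proof -
  obtain ws where "contraction G K = (\<Sum>w\<leftarrow>ws. w \<bullet> (K *v w))"
    using psd_rank_one_decomposition[OF assms(1)] by auto
  then show ?thesis by (auto intro!: sum_list_nonneg simp: assms(2))
qed

lemma contraction_psd_eq_0:
  assumes "psd G" "\<And>x. x \<noteq> 0 \<Longrightarrow> 0 < x \<bullet> (K *v x)" "contraction G K = 0"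
  shows "G = 0"
proof -
  obtain ws where ws: "\<And>K. contraction G K = (\<Sum>w\<leftarrow>ws. w \<bullet> (K *v w))"
    using psd_rank_one_decomposition[OF assms(1)] by auto
  have nn: "0 \<le> x \<bullet> (K *v x)" for x
    using assms(2)[of x] by (cases "x = 0") auto
  have "\<forall>w\<in>set ws. w \<bullet> (K *v w) = 0"
    using assms(3) nn sum_list_nonneg_eq_0_iff[of "map (\<lambda>w. w \<bullet> (K *v w)) ws"] unfolding ws by auto
  then have "\<forall>w\<in>set ws. w = 0"
    using assms(2) by force
  then have "map (\<lambda>w. w \<bullet> (G *v w)) ws = map (\<lambda>_. 0) ws"
    by (intro map_cong) auto
  then have "contraction G G = 0"
    by (simp only: ws) (simp add: sum_list_0)
  then show ?thesis by (rule contraction_self_eq_0)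
qed

section \<open>Functions of finite differentiability order\<close>

lemma Ck_on_cong:
  assumes "open S" "\<And>x. x \<in> S \<Longrightarrow> f x = g x" "Ck_on k S f"
  shows "Ck_on k S g"
  using assms(2,3)
proof (induction k arbitrary: f g)
  case 0
  then have "continuous_on S f" by simp
  then have "continuous_on S g"
    by (rule continuous_on_eq) (rule 0)
  then show ?case by simp
next
  case (Suc k)
  have d: "(g has_derivative frechet_derivative f (at x)) (at x)" if "x \<in> S" for x
  proof (rule has_derivative_transform_within_open)
    show "(f has_derivative frechet_derivative f (at x)) (at x)"
      using Suc.prems(2) that by (simp only: Ck_on.simps frechet_derivative_works[symmetric])
  qed (use assms(1) that Suc.prems(1) in auto)
  have e: "frechet_derivative f (at x) = frechet_derivative g (at x)" if "x \<in> S" for x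
    by (rule frechet_derivative_at[OF d[OF that]])
  show ?case
    unfolding Ck_on.simps
  proof (intro conjI ballI allI)
    show "g differentiable at x" if "x \<in> S" for x
      using d[OF that] by (rule differentiableI)
    show "Ck_on k S (\<lambda>x. frechet_derivative g (at x) v)" for v
    proof (rule Suc.IH[of "\<lambda>x. frechet_derivative f (at x) v"])
      show "Ck_on k S (\<lambda>x. frechet_derivative f (at x) v)"
        using Suc.prems(2) by simp
    qed (simp only: e)
  qed
qed

lemma Ck_on_1I:
  assumes "\<And>x. x \<in> S \<Longrightarrow> (f has_derivative f' x) (at x)"
    "\<And>v. continuous_on S (\<lambda>x. f' x v)"
  shows "Ck_on (Suc 0) S f"
proof -
  have e: "f' x = frechet_derivative f (at x)" if "x \<in> S" for x
    by (rule frechet_derivative_at[OF assms(1)[OF that]])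
  have "continuous_on S (\<lambda>x. frechet_derivative f (at x) v)" for v
    using assms(2)[of v] by (rule continuous_on_eq) (simp only: e)
  moreover have "\<forall>x\<in>S. f differentiable at x"
    using assms(1) by (blast intro: differentiableI)
  ultimately show ?thesis by simp
qed

lemma has_frechet_derivative_bounded_linear:
  assumes "bounded_linear L" "f differentiable at x"
  shows "((\<lambda>x. L (f x)) has_derivative (\<lambda>v. L (frechet_derivative f (at x) v))) (at x)"
  using assms(2) unfolding frechet_derivative_works
  by (rule bounded_linear.has_derivative[OF assms(1)])

lemma frechet_derivative_bounded_linear:
  assumes "bounded_linear L" "f differentiable at x"
  shows "frechet_derivative (\<lambda>x. L (f x)) (at x) v = L (frechet_derivative f (at x) v)"
  using frechet_derivative_at[OF has_frechet_derivative_bounded_linear[OF assms], symmetric]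
  by (rule fun_cong)

lemma Ck_on_bounded_linear:
  assumes "open S" "bounded_linear L" "Ck_on k S f"
  shows "Ck_on k S (\<lambda>x. L (f x))"
  using assms(3)
proof (induction k arbitrary: f)
  case 0
  then show ?case
    using linear_continuous_on_compose assms(2)
    by (auto intro: bounded_linear.continuous_on[OF assms(2)])
next
  case (Suc k)
  show ?case
    unfolding Ck_on.simps
  proof (intro conjI ballI allI)
    show "(\<lambda>x. L (f x)) differentiable at x" if "x \<in> S" for x
      using has_frechet_derivative_bounded_linear[OF assms(2), of f x] Suc.prems that
      by (auto intro: differentiableI)
    show "Ck_on k S (\<lambda>x. frechet_derivative (\<lambda>x. L (f x)) (at x) v)" for v
      using assms(1,2) Suc.prems
      by (intro Ck_on_cong[OF assms(1) _ Suc.IH[of "\<lambda>x. frechet_derivative f (at x) v"]])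
         (auto simp: frechet_derivative_bounded_linear)
  qed
qed

text \<open>Reduces a Frechet derivative to partial derivatives.\<close>

lemma linear_axis_expansion:
  fixes L :: "real^'n \<Rightarrow> 'b::real_normed_vector"
  assumes "linear L"
  shows "L v = (\<Sum>j\<in>UNIV. v $ j *\<^sub>R L (axis j 1))"
proof -
  have "L (\<Sum>j\<in>UNIV. v $ j *\<^sub>R axis j 1) = (\<Sum>j\<in>UNIV. v $ j *\<^sub>R L (axis j 1))"
    using assms by (simp add: linear_sum linear_cmul)
  moreover have "(\<Sum>j\<in>UNIV. v $ j *\<^sub>R axis j 1) = v"
    using basis_expansion[of v] by (simp add: scalar_mult_eq_scaleR)
  ultimately show ?thesis by simp
qed

section \<open>Tensor fields and their contractions in charts\<close>

text \<open>The transformation law alone, detached from smoothness and symmetry, so that it applies to \<open>du \<otimes> dv\<close>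
  and to pullbacks of metrics under maps that are only continuously differentiable.\<close>

definition covariant_law :: "('a, 'n::finite) chart set \<Rightarrow> ('a, 'n) tensor2 \<Rightarrow> bool" where
  "covariant_law A k \<longleftrightarrow> (\<forall>c\<in>A. \<forall>c'\<in>A. \<forall>p\<in>chart_dom c \<inter> chart_dom c'. k c p =
     transpose (transition_jacobian c c' p) ** k c' p ** transition_jacobian c c' p)"

text \<open>A common generalization of \<open>du \<otimes> dv\<close> for real functions and of the pullback metric \<open>\<phi>\<^sup>*h\<close>, so that
  chart independence and continuity are proved once for both.\<close>

definition mixed_pullback ::
    "('a \<Rightarrow> 'b::real_inner) \<Rightarrow> ('a \<Rightarrow> 'b) \<Rightarrow> ('a, 'n::finite) tensor2" where
  "mixed_pullback f f' c p = (\<chi> i j. chart_partial c i f p \<bullet> chart_partial c j f' p)"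

lemma pullback_metric_eq_mixed: "pullback_metric \<phi> = mixed_pullback \<phi> \<phi>"
  by (intro ext) (simp add: pullback_metric_def mixed_pullback_def)

lemma pairing_eq_contraction:
  "pairing A g k p = contraction (g (chart_at A p) p) (k (chart_at A p) p)"
  by (simp add: pairing_def contraction_def Let_def)

lemma cometric_d_eq_pairing: "cometric_d A g u v = pairing A g (mixed_pullback u v)"
  by (intro ext) (simp add: cometric_d_def pairing_def mixed_pullback_def Let_def mult.assoc)

lemma
  fixes B C :: "real^'n^'m"
  shows matrix_mult_diff_left: "A ** (B - C) = A ** B - A ** C"
    and matrix_mult_diff_right: "(B - C) ** D = B ** D - C ** D"
  by (simp_all add: matrix_matrix_mult_def vec_eq_iff sum_subtractf algebra_simps)

lemma covariant_law_diff:
  "covariant_law A k \<Longrightarrow> covariant_law A k' \<Longrightarrow> covariant_law A (\<lambda>c q. k c q - k' c q)"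
  unfolding covariant_law_def matrix_mult_diff_left matrix_mult_diff_right
  by (intro ballI arg_cong2[where f = minus]) blast+

lemma smooth_map_imp_Ck_map: "smooth_map A f \<Longrightarrow> Ck_map k A f"
  by (simp add: smooth_map_def smooth_on_def Ck_map_def)

lemma open_cball_witness:
  assumes "open S" "x \<in> S"
  obtains r where "0 < r" "cball x r \<subseteq> S"
proof -
  have "\<exists>r>0. cball x r \<subseteq> S"
    using assms(1)[unfolded open_contains_cball] assms(2) by (rule bspec)
  then show thesis using that by auto
qed

locale atlas =
  fixes A :: "('a::{t2_space, second_countable_topology}, 'n::finite) chart set"
  assumes smooth_atlas: "smooth_atlas A"
begin

lemma obtain_chart: obtains c where "c \<in> A" "p \<in> chart_dom c"
proof -
  have "p \<in> (\<Union>c\<in>A. chart_dom c)"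
    using smooth_atlas by (simp add: smooth_atlas_def)
  then show thesis using that by blast
qed

lemma chart_at: "chart_at A p \<in> A" "p \<in> chart_dom (chart_at A p)"
  using someI_ex[of "\<lambda>c. c \<in> A \<and> p \<in> chart_dom c"] obtain_chart[of p]
  unfolding chart_at_def by blast+

lemma chart_homeomorphism:
  "c \<in> A \<Longrightarrow> homeomorphism (chart_dom c) (chart_ran c) (snd c) (inv_into (chart_dom c) (snd c))"
  and open_chart_dom: "c \<in> A \<Longrightarrow> open (chart_dom c)"
  and open_chart_ran: "c \<in> A \<Longrightarrow> open (chart_ran c)"
  using smooth_atlas unfolding smooth_atlas_def by blast+

lemma chart_inverse: "c \<in> A \<Longrightarrow> p \<in> chart_dom c \<Longrightarrow> inv_into (chart_dom c) (snd c) (snd c p) = p"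
  using chart_homeomorphism by (blast intro: homeomorphism_apply1)

lemma in_chart_apply: "c \<in> A \<Longrightarrow> p \<in> chart_dom c \<Longrightarrow> in_chart c f (snd c p) = f p"
  by (simp add: in_chart_def chart_inverse)

lemma chart_mem_ran: "p \<in> chart_dom c \<Longrightarrow> snd c p \<in> chart_ran c"
  by (simp add: chart_ran_def)

lemma open_chart_image:
  assumes "c \<in> A" "open U" "U \<subseteq> chart_dom c"
  shows "open (snd c ` U)"
proof -
  have "snd c ` U = inv_into (chart_dom c) (snd c) -` U \<inter> chart_ran c"
    using assms chart_inverse by (force simp: chart_ran_def)
  moreover have "continuous_on (chart_ran c) (inv_into (chart_dom c) (snd c))"
    using chart_homeomorphism[OF assms(1)] by (simp add: homeomorphism_def)
  ultimately show ?thesis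
    using open_chart_ran[OF assms(1)] assms(2) continuous_on_open_vimage by metis
qed

lemma continuous_on_chart: "c \<in> A \<Longrightarrow> continuous_on (chart_dom c) (snd c)"
  using chart_homeomorphism by (simp add: homeomorphism_def)

lemma open_chart_preimage:
  assumes "c \<in> A" "open V"
  shows "open (snd c -` V \<inter> chart_dom c)"
  using continuous_on_open_vimage[OF open_chart_dom] continuous_on_chart assms by blast

lemma continuous_on_chart_dom:
  assumes "c \<in> A" "continuous_on (chart_ran c) (in_chart c f)"
  shows "continuous_on (chart_dom c) f"
proof -
  have "continuous_on (chart_dom c) (in_chart c f \<circ> snd c)"
    using assms continuous_on_chart by (intro continuous_on_compose) (auto simp: chart_ran_def)
  then show ?thesis
    by (rule continuous_on_eq) (simp add: in_chart_apply assms(1))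
qed

lemma continuous_on_from_charts:
  assumes "\<And>c. c \<in> A \<Longrightarrow> continuous_on (chart_dom c) f"
  shows "continuous_on UNIV f"
proof -
  have "continuous_on (\<Union>c\<in>A. chart_dom c) f"
    using assms open_chart_dom by (intro continuous_on_open_UN) auto
  moreover have "(\<Union>c\<in>A. chart_dom c) = UNIV"
    using smooth_atlas by (simp add: smooth_atlas_def)
  ultimately show ?thesis by simp
qed

lemma Ck_map_1_differentiable:
  "Ck_map (Suc 0) A f \<Longrightarrow> c \<in> A \<Longrightarrow> x \<in> chart_ran c \<Longrightarrow> in_chart c f differentiable at x"
  by (simp add: Ck_map_def)

lemma Ck_map_1_continuous:
  assumes "Ck_map (Suc 0) A f"
  shows "continuous_on UNIV f"
proof (rule continuous_on_from_charts)
  fix c assume c: "c \<in> A"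
  have "continuous_on (chart_ran c) (in_chart c f)"
    using Ck_map_1_differentiable[OF assms c]
    by (meson continuous_at_imp_continuous_on differentiable_imp_continuous_within)
  with c show "continuous_on (chart_dom c) f" by (rule continuous_on_chart_dom)
qed

lemma continuous_on_chart_partial:
  assumes "Ck_map (Suc 0) A f" "c \<in> A"
  shows "continuous_on (chart_dom c) (chart_partial c i f)"
proof -
  have "continuous_on (chart_ran c) (\<lambda>x. frechet_derivative (in_chart c f) (at x) (axis i 1))"
    using assms by (simp add: Ck_map_def)
  then have "continuous_on (chart_dom c)
      ((\<lambda>x. frechet_derivative (in_chart c f) (at x) (axis i 1)) \<circ> snd c)"
    using assms continuous_on_chart by (intro continuous_on_compose) (auto simp: chart_ran_def)
  then show ?thesis
    by (simp add: chart_partial_def[abs_def] o_def)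
qed

lemma Ck_map_bounded_linear:
  "bounded_linear L \<Longrightarrow> Ck_map k A f \<Longrightarrow> Ck_map k A (\<lambda>p. L (f p))"
  using Ck_on_bounded_linear[OF open_chart_ran, of _ L k]
  by (auto simp: Ck_map_def in_chart_def o_def)

lemma smooth_map_bounded_linear:
  "bounded_linear L \<Longrightarrow> smooth_map A f \<Longrightarrow> smooth_map A (\<lambda>p. L (f p))"
  using Ck_on_bounded_linear[OF open_chart_ran, of _ L]
  by (auto simp: smooth_map_def smooth_on_def in_chart_def o_def)

lemma chart_partial_bounded_linear:
  assumes "bounded_linear L" "Ck_map (Suc 0) A f" "c \<in> A" "p \<in> chart_dom c"
  shows "chart_partial c i (\<lambda>p. L (f p)) p = L (chart_partial c i f p)"
proof -
  have "in_chart c (\<lambda>p. L (f p)) = (\<lambda>x. L (in_chart c f x))"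
    by (simp add: in_chart_def o_def)
  then show ?thesis
    unfolding chart_partial_def
    using frechet_derivative_bounded_linear[OF assms(1) Ck_map_1_differentiable[OF assms(2,3)]]
      chart_mem_ran[OF assms(4)] by simp
qed

lemma chart_partial_const: "chart_partial c i (\<lambda>_. a) p = 0"
proof -
  have "in_chart c (\<lambda>_. a) = (\<lambda>_. a)" by (simp add: in_chart_def o_def)
  then show ?thesis by (simp add: chart_partial_def)
qed

lemma
  assumes "Ck_map (Suc 0) A f" "Ck_map (Suc 0) A g"
  shows Ck_map_1_add: "Ck_map (Suc 0) A (\<lambda>p. f p + g p)"
    and chart_partial_add: "c \<in> A \<Longrightarrow> p \<in> chart_dom c \<Longrightarrow>
      chart_partial c i (\<lambda>p. f p + g p) p = chart_partial c i f p + chart_partial c i g p"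
proof -
  have e: "in_chart c (\<lambda>p. f p + g p) = (\<lambda>x. in_chart c f x + in_chart c g x)" for c :: "('a, 'n) chart"
    by (simp add: in_chart_def o_def)
  have d: "(in_chart c (\<lambda>p. f p + g p) has_derivative
      (\<lambda>v. frechet_derivative (in_chart c f) (at x) v + frechet_derivative (in_chart c g) (at x) v)) (at x)"
    if "c \<in> A" "x \<in> chart_ran c" for c x
    unfolding e
    by (intro has_derivative_add)
       (simp_all only: frechet_derivative_works[symmetric] Ck_map_1_differentiable[OF _ that] assms)
  show "Ck_map (Suc 0) A (\<lambda>p. f p + g p)"
    unfolding Ck_map_def
  proof
    fix c assume c: "c \<in> A"
    show "Ck_on (Suc 0) (chart_ran c) (in_chart c (\<lambda>p. f p + g p))"
      by (rule Ck_on_1I, rule d[OF c], assumption)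
         (use assms c in \<open>auto simp: Ck_map_def intro!: continuous_on_add\<close>)
  qed
  show "chart_partial c i (\<lambda>p. f p + g p) p = chart_partial c i f p + chart_partial c i g p"
    if "c \<in> A" "p \<in> chart_dom c"
    using frechet_derivative_at[OF d[OF that(1) chart_mem_ran[OF that(2)]], symmetric]
    by (simp add: chart_partial_def)
qed

lemma Ck_map_const: "Ck_map (Suc 0) A (\<lambda>_. a)"
proof -
  have "in_chart c (\<lambda>_. a) = (\<lambda>_. a)" for c :: "('a, 'n) chart" by (simp add: in_chart_def o_def)
  then show ?thesis by (simp add: Ck_map_def)
qed

lemma transition_has_derivative:
  assumes "c \<in> A" "c' \<in> A" "p \<in> chart_dom c" "p \<in> chart_dom c'"
  shows "(in_chart c (snd c') has_derivative (*v) (transition_jacobian c c' p)) (at (snd c p))"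
proof -
  have "Ck_on (Suc 0) (snd c ` (chart_dom c \<inter> chart_dom c')) (in_chart c (snd c'))"
    using smooth_atlas assms(1,2) unfolding smooth_atlas_def smooth_on_def by blast
  then have "in_chart c (snd c') differentiable at (snd c p)"
    using assms(3,4) by auto
  then show ?thesis
    by (simp add: jacobian_works transition_jacobian_def)
qed

lemma chart_partial_change:
  assumes f: "Ck_map (Suc 0) A f" and c: "c \<in> A" "c' \<in> A" and p: "p \<in> chart_dom c" "p \<in> chart_dom c'"
  shows "chart_partial c i f p =
    (\<Sum>j\<in>UNIV. transition_jacobian c c' p $ j $ i *\<^sub>R chart_partial c' j f p)"
proof -
  define J where "J = transition_jacobian c c' p"
  define W where "W = snd c ` (chart_dom c \<inter> chart_dom c')"
  define D where "D = frechet_derivative (in_chart c' f) (at (snd c' p))"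
  have x: "in_chart c (snd c') (snd c p) = snd c' p"
    using c p by (simp add: in_chart_apply)
  have D: "(in_chart c' f has_derivative D) (at (in_chart c (snd c') (snd c p)))"
    using Ck_map_1_differentiable[OF f c(2) chart_mem_ran[OF p(2)]]
    unfolding x D_def frechet_derivative_works .
  have "(in_chart c' f \<circ> in_chart c (snd c') has_derivative D \<circ> (*v) J) (at (snd c p))"
    using diff_chain_at[OF transition_has_derivative[OF c p] D] by (simp add: J_def)
  then have "(in_chart c f has_derivative D \<circ> (*v) J) (at (snd c p))"
  proof (rule has_derivative_transform_within_open)
    show "open W"
      unfolding W_def using c open_chart_dom by (intro open_chart_image open_Int) auto
    show "snd c p \<in> W" using p by (simp add: W_def)
    show "(in_chart c' f \<circ> in_chart c (snd c')) y = in_chart c f y" if "y \<in> W" for y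
      using that c by (auto simp: W_def in_chart_apply)
  qed
  then have "chart_partial c i f p = D (J *v axis i 1)"
    unfolding chart_partial_def by (simp add: frechet_derivative_at[symmetric])
  also have "\<dots> = (\<Sum>j\<in>UNIV. (J *v axis i 1) $ j *\<^sub>R D (axis j 1))"
    using D by (intro linear_axis_expansion has_derivative_linear)
  finally show ?thesis
    by (simp add: J_def D_def chart_partial_def matrix_vector_mult_basis column_def)
qed

lemma covariant_law_mixed_pullback:
  assumes "Ck_map (Suc 0) A f" "Ck_map (Suc 0) A f'"
  shows "covariant_law A (mixed_pullback f f')"
  unfolding covariant_law_def
proof (intro ballI)
  fix c c' p assume c: "c \<in> A" "c' \<in> A" and "p \<in> chart_dom c \<inter> chart_dom c'"
  then have p: "p \<in> chart_dom c" "p \<in> chart_dom c'" by auto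
  define J where "J = transition_jacobian c c' p"
  have "mixed_pullback f f' c p $ i $ j = (transpose J ** mixed_pullback f f' c' p ** J) $ i $ j" for i j
  proof -
    have "mixed_pullback f f' c p $ i $ j =
      (\<Sum>l\<in>UNIV. \<Sum>k\<in>UNIV. J $ k $ i * (J $ l $ j * (chart_partial c' k f p \<bullet> chart_partial c' l f' p)))"
      using chart_partial_change[OF assms(1) c p] chart_partial_change[OF assms(2) c p]
      by (simp add: mixed_pullback_def J_def inner_sum_left inner_sum_right sum_distrib_left mult_ac)
    also have "\<dots> = (transpose J ** mixed_pullback f f' c' p ** J) $ i $ j"
      by (simp add: matrix_matrix_mult_def transpose_def mixed_pullback_def sum_distrib_right sum_distrib_left mult_ac)
    finally show ?thesis .
  qed
  then show "mixed_pullback f f' c p = transpose (transition_jacobian c c' p) ** mixed_pullback f f' c' p **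
      transition_jacobian c c' p"
    by (simp add: vec_eq_iff J_def)
qed

lemma pairing_in_chart:
  assumes "sym_contra2 A g" "covariant_law A k" "c \<in> A" "p \<in> chart_dom c"
  shows "pairing A g k p = contraction (g c p) (k c p)"
proof -
  define J where "J = transition_jacobian (chart_at A p) c p"
  have "g c p = J ** g (chart_at A p) p ** transpose J"
    and "k (chart_at A p) p = transpose J ** k c p ** J"
    using assms chart_at[of p] unfolding sym_contra2_def covariant_law_def J_def by blast+
  then show ?thesis
    by (simp add: pairing_eq_contraction contraction_congruence)
qed

lemma continuous_pairing:
  assumes "sym_contra2 A g" "covariant_law A k" "\<And>c. c \<in> A \<Longrightarrow> continuous_on (chart_dom c) (k c)"
  shows "continuous_on UNIV (pairing A g k)"
proof (rule continuous_on_from_charts)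
  fix c assume c: "c \<in> A"
  have "Ck_on 0 (chart_ran c) (in_chart c (g c))"
    using assms(1) c unfolding sym_contra2_def smooth_on_def by blast
  then have "continuous_on (chart_dom c) (g c)"
    using c by (intro continuous_on_chart_dom) auto
  then have "continuous_on (chart_dom c) (\<lambda>p. contraction (g c p) (k c p))"
    using assms(3)[OF c] unfolding contraction_def
    by (intro continuous_intros)
  then show "continuous_on (chart_dom c) (pairing A g k)"
    by (rule continuous_on_eq) (simp add: pairing_in_chart[OF assms(1,2) c])
qed

lemma continuous_mixed_pullback:
  assumes "Ck_map (Suc 0) A f" "Ck_map (Suc 0) A f'" "c \<in> A"
  shows "continuous_on (chart_dom c) (mixed_pullback f f' c)"
  unfolding mixed_pullback_def[abs_def]
  using assms by (intro continuous_on_vec_lambda continuous_on_inner continuous_on_chart_partial)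

lemma continuous_cometric_d:
  assumes "sym_contra2 A g" "Ck_map (Suc 0) A u" "Ck_map (Suc 0) A v"
  shows "continuous_on UNIV (cometric_d A g u v)"
  unfolding cometric_d_eq_pairing
  using assms by (intro continuous_pairing covariant_law_mixed_pullback continuous_mixed_pullback)

lemma
  fixes u v :: "'a \<Rightarrow> real"
  assumes "Ck_map (Suc 0) A u" "Ck_map (Suc 0) A v"
  shows Ck_map_1_combination: "Ck_map (Suc 0) A (\<lambda>p. u p + t * v p)"
    and chart_partial_combination: "c \<in> A \<Longrightarrow> p \<in> chart_dom c \<Longrightarrow>
      chart_partial c i (\<lambda>p. u p + t * v p) p = chart_partial c i u p + t * chart_partial c i v p"
proof -
  have tv: "Ck_map (Suc 0) A (\<lambda>p. t * v p)"
    using assms(2) by (rule Ck_map_bounded_linear[OF bounded_linear_mult_right])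
  show "Ck_map (Suc 0) A (\<lambda>p. u p + t * v p)"
    using assms(1) tv by (rule Ck_map_1_add)
  show "chart_partial c i (\<lambda>p. u p + t * v p) p = chart_partial c i u p + t * chart_partial c i v p"
    if "c \<in> A" "p \<in> chart_dom c"
    using chart_partial_add[OF assms(1) tv that]
      chart_partial_bounded_linear[OF bounded_linear_mult_right assms(2) that] by simp
qed

text \<open>The derivative of the coordinate expression vanishes on a ball, which is convex.\<close>

lemma locally_constant_of_zero_partials:
  fixes u :: "'a \<Rightarrow> real"
  assumes u: "Ck_map (Suc 0) A u"
    and zero: "\<And>c q i. c \<in> A \<Longrightarrow> q \<in> chart_dom c \<Longrightarrow> chart_partial c i u q = 0"
  shows "eventually (\<lambda>q. u p = u q) (at p)"
proof -
  obtain c where c: "c \<in> A" "p \<in> chart_dom c" by (rule obtain_chart)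
  obtain r where r: "0 < r" "cball (snd c p) r \<subseteq> chart_ran c"
    by (rule open_cball_witness[OF open_chart_ran[OF c(1)] chart_mem_ran[OF c(2)]])
  define U where "U = snd c -` ball (snd c p) r \<inter> chart_dom c"
  have D: "(in_chart c u has_derivative (\<lambda>_. 0)) (at x within ball (snd c p) r)"
    if "x \<in> ball (snd c p) r" for x
  proof -
    have "x \<in> cball (snd c p) r" using that by auto
    then have "x \<in> chart_ran c" using r(2) by blast
    then obtain q where q: "q \<in> chart_dom c" "x = snd c q" by (auto simp: chart_ran_def)
    have d: "(in_chart c u has_derivative frechet_derivative (in_chart c u) (at x)) (at x)"
      using Ck_map_1_differentiable[OF u c(1) \<open>x \<in> chart_ran c\<close>] unfolding frechet_derivative_works .
    have "frechet_derivative (in_chart c u) (at x) v = 0" for v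
      using linear_axis_expansion[OF has_derivative_linear[OF d], of v] zero[OF c(1) q(1)]
      by (simp add: chart_partial_def q(2))
    then have "frechet_derivative (in_chart c u) (at x) = (\<lambda>_. 0)" by auto
    with d show ?thesis by (metis has_derivative_at_withinI)
  qed
  have "u p = u q" if "q \<in> U" for q
  proof -
    have "in_chart c u (snd c p) = in_chart c u (snd c q)"
      using that r(1) by (intro has_derivative_zero_unique[OF convex_ball D]) (auto simp: U_def)
    then show ?thesis
      using that c by (simp add: in_chart_apply U_def)
  qed
  moreover have "open U" "p \<in> U"
    using open_chart_preimage[OF c(1) open_ball] c(2) r(1) by (auto simp: U_def)
  ultimately show ?thesis
    unfolding eventually_at_topological by (intro exI[of _ U]) simp
qed

end

section \<open>The volume measure\<close>

locale weighted_manifold = atlas A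
  for A :: "('a::{t2_space, second_countable_topology}, 'n::finite) chart set" +
  fixes \<mu> :: "'a measure"
  assumes compact: "compact (UNIV :: 'a set)"
    and connected: "connected (UNIV :: 'a set)"
    and volume: "smooth_volume A \<mu>"
begin

lemma sets_volume [measurable_cong]: "sets \<mu> = sets borel"
  using volume by (simp add: smooth_volume_def)

lemma space_volume: "space \<mu> = UNIV"
  using sets_eq_imp_space_eq[OF sets_volume] by simp

lemma volume_density:
  assumes "c \<in> A"
  shows "\<exists>\<rho>. continuous_on (chart_ran c) \<rho> \<and> (\<forall>x\<in>chart_ran c. 0 < \<rho> x) \<and>
    (\<forall>U. open U \<longrightarrow> U \<subseteq> chart_dom c \<longrightarrow>
      emeasure \<mu> U = (\<integral>\<^sup>+x. ennreal (\<rho> x) * indicator (snd c ` U) x \<partial>lborel))"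
proof -
  obtain \<rho> where \<rho>: "smooth_on (chart_ran c) \<rho>" "\<forall>x\<in>chart_ran c. \<rho> x > 0"
    "\<forall>B\<in>sets borel. B \<subseteq> chart_dom c \<longrightarrow>
           emeasure \<mu> B = (\<integral>\<^sup>+x. ennreal (\<rho> x) * indicator (snd c ` B) x \<partial>lborel)"
    using volume assms unfolding smooth_volume_def by blast
  have "Ck_on 0 (chart_ran c) \<rho>"
    using \<rho>(1) unfolding smooth_on_def by blast
  then show ?thesis
    using \<rho>(2,3) by (intro exI[of _ \<rho>]) auto
qed

text \<open>On the preimage of a small closed ball in a chart the density is bounded; finitely many such
  preimages cover the compact manifold.\<close>

lemma finite_measure_volume: "finite_measure \<mu>"
proof -
  have "\<exists>U. open U \<and> p \<in> U \<and> emeasure \<mu> U < \<infinity>" for p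
  proof -
    obtain c where c: "c \<in> A" "p \<in> chart_dom c" by (rule obtain_chart)
    obtain \<rho> where \<rho>: "continuous_on (chart_ran c) \<rho>" "\<forall>x\<in>chart_ran c. 0 < \<rho> x"
    "\<forall>U. open U \<longrightarrow> U \<subseteq> chart_dom c \<longrightarrow>
      emeasure \<mu> U = (\<integral>\<^sup>+x. ennreal (\<rho> x) * indicator (snd c ` U) x \<partial>lborel)"
    using volume_density[OF c(1)] by (elim exE conjE) (rule that)
    obtain r where r: "0 < r" "cball (snd c p) r \<subseteq> chart_ran c"
      by (rule open_cball_witness[OF open_chart_ran[OF c(1)] chart_mem_ran[OF c(2)]])
    have "\<exists>x\<in>cball (snd c p) r. \<forall>y\<in>cball (snd c p) r. \<rho> y \<le> \<rho> x"
      using r continuous_on_subset[OF \<rho>(1) r(2)] by (intro continuous_attains_sup) auto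
    then obtain b where b: "\<And>y. y \<in> cball (snd c p) r \<Longrightarrow> \<rho> y \<le> b" by blast
    define U where "U = snd c -` ball (snd c p) r \<inter> chart_dom c"
    have U: "open U" "U \<subseteq> chart_dom c" "p \<in> U"
      using open_chart_preimage[OF c(1)] c(2) r(1) by (auto simp: U_def)
    have "emeasure \<mu> U = (\<integral>\<^sup>+x. ennreal (\<rho> x) * indicator (snd c ` U) x \<partial>lborel)"
      using U \<rho>(3) by blast
    also have "\<dots> \<le> (\<integral>\<^sup>+x. ennreal b * indicator (ball (snd c p) r) x \<partial>lborel)"
      using b by (intro nn_integral_mono) (auto simp: U_def indicator_def intro!: ennreal_leI)
    also have "\<dots> = ennreal b * emeasure lborel (ball (snd c p) r)"
      by (simp add: nn_integral_cmult_indicator)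
    also have "\<dots> < \<infinity>"
      using emeasure_lborel_ball_finite[of "snd c p" r] by (simp add: ennreal_mult_less_top)
    finally show ?thesis using U by blast
  qed
  then obtain U where U: "\<And>p. open (U p)" "\<And>p. p \<in> U p" "\<And>p. emeasure \<mu> (U p) < \<infinity>"
    by metis
  have "UNIV \<subseteq> (\<Union>p. U p)" using U(2) by auto
  then obtain F where F: "finite F" "UNIV \<subseteq> (\<Union>p\<in>F. U p)"
    by (rule compactE_image[OF compact U(1)])
  have "emeasure \<mu> (space \<mu>) = emeasure \<mu> (\<Union>p\<in>F. U p)"
    using F(2) by (intro arg_cong[where f = "emeasure \<mu>"]) (auto simp: space_volume)
  also have "\<dots> \<le> (\<Sum>p\<in>F. emeasure \<mu> (U p))"
    using F U by (intro emeasure_subadditive_finite) (auto simp: sets_volume)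
  also have "\<dots> < \<infinity>"
    using U(3) F(1) by (simp add: ennreal_sum_less_top)
  finally show ?thesis by (intro finite_measureI) auto
qed

sublocale finite_measure \<mu>
  by (rule finite_measure_volume)

text \<open>On a small closed ball the continuous positive density is bounded away from zero.\<close>

lemma emeasure_open_pos:
  assumes "open U" "p \<in> U"
  shows "0 < emeasure \<mu> U"
proof -
  obtain c where c: "c \<in> A" "p \<in> chart_dom c" by (rule obtain_chart)
  obtain \<rho> where \<rho>: "continuous_on (chart_ran c) \<rho>" "\<forall>x\<in>chart_ran c. 0 < \<rho> x"
    "\<forall>U. open U \<longrightarrow> U \<subseteq> chart_dom c \<longrightarrow>
      emeasure \<mu> U = (\<integral>\<^sup>+x. ennreal (\<rho> x) * indicator (snd c ` U) x \<partial>lborel)"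
    using volume_density[OF c(1)] by (elim exE conjE) (rule that)
  define W where "W = U \<inter> chart_dom c"
  have W: "open W" "W \<subseteq> chart_dom c" "p \<in> W" "W \<subseteq> U"
    using assms c open_chart_dom[OF c(1)] by (auto simp: W_def)
  have "open (snd c ` W)" using c(1) W by (intro open_chart_image)
  then obtain r where r: "0 < r" "cball (snd c p) r \<subseteq> snd c ` W"
    using open_cball_witness[of "snd c ` W" "snd c p"] W(3) by blast
  have r': "cball (snd c p) r \<subseteq> chart_ran c"
    using r(2) image_mono[OF W(2)] unfolding chart_ran_def by (rule order_trans)
  have "\<exists>x\<in>cball (snd c p) r. \<forall>y\<in>cball (snd c p) r. \<rho> x \<le> \<rho> y"
    using r continuous_on_subset[OF \<rho>(1) r'] by (intro continuous_attains_inf) auto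
  then obtain b where b: "0 < b" "\<And>y. y \<in> cball (snd c p) r \<Longrightarrow> b \<le> \<rho> y"
    using \<rho>(2) r' by blast
  have "0 < measure lborel (ball (snd c p) r)"
    using r(1) by (rule content_ball_pos)
  then have "emeasure lborel (ball (snd c p) r) \<noteq> 0"
    by (auto simp: measure_def)
  with b(1) have "0 < ennreal b * emeasure lborel (ball (snd c p) r)"
    by (simp add: ennreal_zero_less_mult_iff zero_less_iff_neq_zero)
  also have "\<dots> = (\<integral>\<^sup>+x. ennreal b * indicator (ball (snd c p) r) x \<partial>lborel)"
    by (simp add: nn_integral_cmult_indicator)
  also have "\<dots> \<le> (\<integral>\<^sup>+x. ennreal (\<rho> x) * indicator (snd c ` W) x \<partial>lborel)"
  proof (rule nn_integral_mono)
    fix x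
    show "ennreal b * indicator (ball (snd c p) r) x \<le> ennreal (\<rho> x) * indicator (snd c ` W) x"
    proof (cases "x \<in> ball (snd c p) r")
      case True
      then have "x \<in> cball (snd c p) r" by auto
      with r(2) b(2) have "x \<in> snd c ` W" "b \<le> \<rho> x" by blast+
      with True show ?thesis by (simp add: ennreal_leI)
    qed simp
  qed
  also have "\<dots> = emeasure \<mu> W"
    using W \<rho>(3) by simp
  also have "\<dots> \<le> emeasure \<mu> U"
    using W assms by (intro emeasure_mono) (auto simp: sets_volume)
  finally show ?thesis .
qed

lemma total_volume_pos: "0 < measure \<mu> UNIV"
  using emeasure_open_pos[of UNIV undefined] by (simp add: emeasure_eq_measure)

lemma borel_measurable_continuous:
  fixes f :: "'a \<Rightarrow> 'b::topological_space"
  assumes "continuous_on UNIV f"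
  shows "f \<in> borel_measurable \<mu>"
  using borel_measurable_continuous_onI[OF assms] measurable_cong_sets[OF sets_volume refl] by blast

lemma integrable_continuous:
  fixes f :: "'a \<Rightarrow> 'b::{banach, second_countable_topology}"
  assumes "continuous_on UNIV f"
  shows "integrable \<mu> f"
proof -
  have "bounded (range f)"
    using compact_continuous_image[OF assms compact] by (rule compact_imp_bounded)
  then obtain B where "\<And>p. norm (f p) \<le> B" unfolding bounded_iff by auto
  then show ?thesis
    using borel_measurable_continuous[OF assms] by (intro integrable_const_bound[where B = B]) auto
qed

lemma continuous_nonneg_integral_zero:
  fixes f :: "'a \<Rightarrow> real"
  assumes "continuous_on UNIV f" "\<And>p. 0 \<le> f p" "(\<integral>p. f p \<partial>\<mu>) = 0"
  shows "f p = 0"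
proof (rule ccontr)
  assume p: "f p \<noteq> 0"
  have "AE p in \<mu>. f p = 0"
    using integral_nonneg_eq_0_iff_AE[OF integrable_continuous[OF assms(1)]] assms(2,3) by simp
  moreover have o: "open {p. f p \<noteq> 0}"
    using assms(1) by (intro open_Collect_neq continuous_on_const)
  ultimately have "emeasure \<mu> {p. f p \<noteq> 0} = 0"
    using emeasure_eq_0_AE[of "\<lambda>p. f p \<noteq> 0" \<mu>] by (simp add: space_volume)
  with emeasure_open_pos[OF o, of p] p show False by simp
qed

lemma integral_normalized:
  fixes f :: "'a \<Rightarrow> 'b::{banach, second_countable_topology}"
  assumes "continuous_on UNIV f"
  shows "(\<integral>p. f p \<partial>normalized \<mu>) = (\<integral>p. f p \<partial>\<mu>) /\<^sub>R measure \<mu> UNIV"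
proof -
  have "normalized \<mu> = density \<mu> (\<lambda>_. ennreal (1 / measure \<mu> UNIV))"
    unfolding normalized_def uniform_measure_def space_volume
    using total_volume_pos by (simp add: emeasure_eq_measure divide_ennreal flip: ennreal_1)
  then have "(\<integral>p. f p \<partial>normalized \<mu>) = (\<integral>p. (1 / measure \<mu> UNIV) *\<^sub>R f p \<partial>\<mu>)"
    using borel_measurable_continuous[OF assms] by (simp add: integral_density)
  then show ?thesis by (simp add: divide_inverse)
qed

text \<open>The partial sums are dominated by the sum itself, which is integrable as a continuous function.\<close>

lemma sums_integral_continuous:
  fixes f :: "nat \<Rightarrow> 'a \<Rightarrow> real"
  assumes "\<And>k. continuous_on UNIV (f k)" "continuous_on UNIV s"
    "\<And>k p. 0 \<le> f k p" "\<And>p. (\<lambda>k. f k p) sums s p"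
  shows "(\<lambda>k. \<integral>p. f k p \<partial>\<mu>) sums (\<integral>p. s p \<partial>\<mu>)"
proof -
  have "(\<lambda>n. \<integral>p. (\<Sum>k<n. f k p) \<partial>\<mu>) \<longlonglongrightarrow> (\<integral>p. s p \<partial>\<mu>)"
  proof (rule integral_dominated_convergence[where w = s])
    show "s \<in> borel_measurable \<mu>" using assms(2) by (rule borel_measurable_continuous)
    show "integrable \<mu> s" using assms(2) by (rule integrable_continuous)
    show "(\<lambda>p. \<Sum>k<n. f k p) \<in> borel_measurable \<mu>" for n
      using assms(1) by (intro borel_measurable_continuous continuous_on_sum)
    show "AE p in \<mu>. (\<lambda>n. \<Sum>k<n. f k p) \<longlonglongrightarrow> s p"
      using assms(4) by (simp add: sums_def)
    show "AE p in \<mu>. norm (\<Sum>k<n. f k p) \<le> s p" for n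
    proof (rule AE_I2)
      fix p
      have "(\<Sum>k<n. f k p) \<le> s p"
        unfolding sums_unique[OF assms(4)[of p]]
        by (intro sum_le_suminf sums_summable[OF assms(4)] finite_lessThan assms(3))
      then show "norm (\<Sum>k<n. f k p) \<le> s p"
        using assms(3) by (simp add: sum_nonneg)
    qed
  qed
  then show ?thesis
    using integrable_continuous[OF assms(1)] by (simp add: sums_def Bochner_Integration.integral_sum)
qed

end

section \<open>A nonconstant continuously differentiable function\<close>

text \<open>The remainder of the linear approximation is at most \<open>(s - t)\<^sup>2\<close> for all real \<open>s\<close> and \<open>t\<close>, which covers
  the corner of the positive part as well.\<close>

lemma has_real_derivative_pos_part_square:
  "((\<lambda>t::real. (max 0 t)\<^sup>2) has_real_derivative 2 * max 0 t) (at t)"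
  unfolding has_field_derivative_def
proof (rule has_derivativeI_sandwich[where e = 1 and H = "\<lambda>s. \<bar>s - t\<bar>"])
  show "bounded_linear ((*) (2 * max 0 t))" by (rule bounded_linear_mult_right)
  have "((\<lambda>s. \<bar>s - t\<bar>) \<longlongrightarrow> \<bar>t - t\<bar>) (at t)"
    by (intro tendsto_intros)
  then show "((\<lambda>s. \<bar>s - t\<bar>) \<longlongrightarrow> 0) (at t)" by simp
  fix s assume "s \<noteq> t"
  have "\<bar>(max 0 s)\<^sup>2 - (max 0 t)\<^sup>2 - 2 * max 0 t * (s - t)\<bar> \<le> (s - t)\<^sup>2"
  proof (cases "0 \<le> s"; cases "0 \<le> t")
    assume "\<not> 0 \<le> s" "0 \<le> t"
    then have "s * t \<le> 0" by (simp add: mult_nonpos_nonneg)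
    moreover have "\<bar>t * t - s * (t * 2)\<bar> = t * t - s * (t * 2)"
      using \<open>s * t \<le> 0\<close> zero_le_square[of t]
      by (intro abs_of_nonneg, unfold mult.assoc[symmetric]) linarith
    ultimately show ?thesis using \<open>\<not> 0 \<le> s\<close> \<open>0 \<le> t\<close>
      by (simp add: max_def power2_eq_square algebra_simps)
  next
    assume "0 \<le> s" "\<not> 0 \<le> t"
    then have "s * t \<le> 0" by (simp add: mult_nonneg_nonpos)
    moreover have "0 \<le> t * t" by simp
    ultimately show ?thesis using \<open>0 \<le> s\<close> \<open>\<not> 0 \<le> t\<close>
      by (simp add: max_def power2_eq_square algebra_simps)
  next
    assume "0 \<le> s" "0 \<le> t"
    then have "(max 0 s)\<^sup>2 - (max 0 t)\<^sup>2 - 2 * max 0 t * (s - t) = (s - t)\<^sup>2"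
      by (simp add: power2_eq_square algebra_simps)
    then show ?thesis by simp
  next
    assume "\<not> 0 \<le> s" "\<not> 0 \<le> t"
    then have "(max 0 s)\<^sup>2 - (max 0 t)\<^sup>2 - 2 * max 0 t * (s - t) = 0"
      by (simp add: max_def)
    then show ?thesis by simp
  qed
  then have "\<bar>(max 0 s)\<^sup>2 - (max 0 t)\<^sup>2 - 2 * max 0 t * (s - t)\<bar> \<le> \<bar>s - t\<bar> * \<bar>s - t\<bar>"
    by (simp add: power2_eq_square)
  then show "norm ((max 0 s)\<^sup>2 - (max 0 t)\<^sup>2 - 2 * max 0 t * (s - t)) / norm (s - t) \<le> \<bar>s - t\<bar>"
    using \<open>s \<noteq> t\<close> by (simp add: divide_le_eq)
qed simp

lemma Ck_on_1_bump:
  fixes \<psi> :: "'e::euclidean_space \<Rightarrow> 'b::real_inner"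
  assumes "Ck_on (Suc 0) S \<psi>"
  shows "Ck_on (Suc 0) S (\<lambda>y. (max 0 (r\<^sup>2 - (\<psi> y - z) \<bullet> (\<psi> y - z)))\<^sup>2)"
proof (rule Ck_on_1I)
  define D where "D x = frechet_derivative \<psi> (at x)" for x
  have D: "(\<psi> has_derivative D x) (at x)" if "x \<in> S" for x
    using assms that unfolding D_def frechet_derivative_works[symmetric] by simp
  show "((\<lambda>y. (max 0 (r\<^sup>2 - (\<psi> y - z) \<bullet> (\<psi> y - z)))\<^sup>2) has_derivative
      (\<lambda>v. - (2 * ((\<psi> x - z) \<bullet> D x v)) * (2 * max 0 (r\<^sup>2 - (\<psi> x - z) \<bullet> (\<psi> x - z))))) (at x)"
    if "x \<in> S" for x
  proof (rule DERIV_compose_FDERIV[OF has_real_derivative_pos_part_square])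
    show "((\<lambda>y. r\<^sup>2 - (\<psi> y - z) \<bullet> (\<psi> y - z)) has_derivative (\<lambda>v. - (2 * ((\<psi> x - z) \<bullet> D x v)))) (at x)"
      using D[OF that] by (auto intro!: derivative_eq_intros simp: inner_commute)
  qed
  have "continuous_on S \<psi>"
    using D by (meson continuous_at_imp_continuous_on has_derivative_continuous)
  moreover have "continuous_on S (\<lambda>x. D x v)" for v
    using assms by (simp add: D_def)
  ultimately show "continuous_on S (\<lambda>x. - (2 * ((\<psi> x - z) \<bullet> D x v)) * (2 * max 0 (r\<^sup>2 - (\<psi> x - z) \<bullet> (\<psi> x - z))))" for v
    by (intro continuous_intros)
qed

lemma Ck_on_Un: "open S \<Longrightarrow> open T \<Longrightarrow> Ck_on k S f \<Longrightarrow> Ck_on k T f \<Longrightarrow> Ck_on k (S \<union> T) f"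
  by (induction k arbitrary: f) (auto intro: continuous_on_open_Un)

context atlas
begin

text \<open>The bump \<open>(max 0 (r\<^sup>2 - \<bar>x - z\<bar>\<^sup>2))\<^sup>2\<close> in a chart, extended by zero. The manifold is Hausdorff, so the
  preimage \<open>K\<close> of the closed ball is closed; any other chart is covered by the open parts in which the
  extension is either the bump after a transition map or zero. Positive dimension provides a point on the
  sphere of radius \<open>r\<close>, where the bump vanishes.\<close>

lemma exists_nonconstant_C1: "\<exists>u :: 'a \<Rightarrow> real. Ck_map (Suc 0) A u \<and> (\<exists>p q. u p \<noteq> u q)"
proof -
  obtain c :: "('a, 'n) chart" and p where c: "c \<in> A" "p \<in> chart_dom c"
    using obtain_chart[of undefined] by metis
  define z where "z = snd c p"
  obtain r where r: "0 < r" "cball z r \<subseteq> chart_ran c"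
    unfolding z_def by (rule open_cball_witness[OF open_chart_ran[OF c(1)] chart_mem_ran[OF c(2)]])
  define b where "b x = (max 0 (r\<^sup>2 - (x - z) \<bullet> (x - z)))\<^sup>2" for x :: "real^'n"
  define K where "K = inv_into (chart_dom c) (snd c) ` cball z r"
  define u where "u q = (if q \<in> chart_dom c then b (snd c q) else 0)" for q
  have b0: "b x = 0" if "r \<le> norm (x - z)" for x
  proof -
    have "r\<^sup>2 \<le> (norm (x - z))\<^sup>2" using that r(1) by (intro power_mono) auto
    then show ?thesis by (simp add: b_def power2_norm_eq_inner)
  qed
  have "continuous_on (cball z r) (inv_into (chart_dom c) (snd c))"
    using chart_homeomorphism[OF c(1)] r(2) unfolding homeomorphism_def
    by (blast intro: continuous_on_subset)
  then have "compact K"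
    unfolding K_def by (rule compact_continuous_image) (rule compact_cball)
  then have "open (- K)"
    by (simp add: compact_imp_closed open_Compl)
  have Kdom: "K \<subseteq> chart_dom c"
    using r(2) by (auto simp: K_def chart_ran_def intro!: inv_into_into)
  have uK: "u q = 0" if "q \<notin> K" for q
  proof (cases "q \<in> chart_dom c")
    case True
    have "snd c q \<notin> cball z r"
    proof
      assume "snd c q \<in> cball z r"
      then have "inv_into (chart_dom c) (snd c) (snd c q) \<in> K"
        unfolding K_def by (rule imageI)
      with that show False using chart_inverse[OF c(1) True] by simp
    qed
    then show ?thesis using True by (simp add: u_def b0 dist_norm norm_minus_commute)
  qed (simp add: u_def)
  have "Ck_map (Suc 0) A u"
    unfolding Ck_map_def
  proof
    fix c' assume c': "c' \<in> A"
    define W1 where "W1 = snd c' ` (chart_dom c' \<inter> chart_dom c)"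
    define W2 where "W2 = snd c' ` (chart_dom c' \<inter> - K)"
    have W: "open W1" "open W2"
      unfolding W1_def W2_def using c c' open_chart_dom \<open>open (- K)\<close>
      by (intro open_chart_image open_Int; blast)+
    have "Ck_on (Suc 0) W1 (in_chart c' (snd c))"
      using smooth_atlas c c' unfolding smooth_atlas_def smooth_on_def W1_def by blast
    then have "Ck_on (Suc 0) W1 (\<lambda>y. b (in_chart c' (snd c) y))"
      unfolding b_def by (rule Ck_on_1_bump)
    moreover have "b (in_chart c' (snd c) y) = in_chart c' u y" if "y \<in> W1" for y
      using that c' by (auto simp: W1_def in_chart_apply u_def)
    ultimately have 1: "Ck_on (Suc 0) W1 (in_chart c' u)"
      by (rule Ck_on_cong[OF W(1), rotated])
    have "Ck_on (Suc 0) W2 (\<lambda>_. 0 :: real)" by simp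
    moreover have "0 = in_chart c' u y" if "y \<in> W2" for y
      using that c' by (auto simp: W2_def in_chart_apply uK)
    ultimately have 2: "Ck_on (Suc 0) W2 (in_chart c' u)"
      by (rule Ck_on_cong[OF W(2), rotated])
    have "chart_ran c' = W1 \<union> W2"
      using Kdom by (auto simp: chart_ran_def W1_def W2_def)
    then show "Ck_on (Suc 0) (chart_ran c') (in_chart c' u)"
      using Ck_on_Un[OF W 1 2] by simp
  qed
  moreover have "u p \<noteq> 0"
    using c r(1) by (simp add: u_def z_def[symmetric] b_def)
  moreover have "\<exists>q. u q = 0"
  proof -
    \<comment> \<open>a point of the chart on the boundary of the support\<close>
    define x where "x = z + r *\<^sub>R axis (undefined :: 'n) 1"
    have nx: "norm (x - z) = r" using r(1) by (simp add: x_def)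
    then have "x \<in> chart_ran c"
      using r(2) by (auto simp: dist_norm norm_minus_commute)
    then obtain q where "q \<in> chart_dom c" "x = snd c q" by (auto simp: chart_ran_def)
    with b0[of x] nx show ?thesis by (intro exI[of _ q]) (simp add: u_def)
  qed
  ultimately show ?thesis by metis
qed

end

section \<open>Rayleigh quotients\<close>

lemma mixed_pullback_quadratic_form:
  fixes f :: "'a \<Rightarrow> 'b::real_inner" and c :: "('a, 'n::finite) chart"
  shows "v \<bullet> (mixed_pullback f f c p *v v) = (norm (\<Sum>i\<in>UNIV. v $ i *\<^sub>R chart_partial c i f p))\<^sup>2"
  unfolding quadratic_form_sum power2_norm_eq_inner
  by (simp add: mixed_pullback_def inner_sum_left inner_sum_right sum_distrib_left mult_ac)
     (intro sum.cong refl, simp add: inner_commute)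

lemma pairing_diff:
  "pairing A g (\<lambda>c q. k c q - k' c q) p = pairing A g k p - pairing A g k' p"
  by (simp add: pairing_eq_contraction contraction_diff_right)

lemma bounded_linear_l2_nth: "bounded_linear (\<lambda>x. l2_nth x k)"
  using l2_nth_le_norm
  by (intro bounded_linear_intro[where K = 1]) (auto simp: plus_l2.rep_eq scaleR_l2.rep_eq)

lemma l2_inner_sums: "(\<lambda>k. l2_nth x k * l2_nth y k) sums (x \<bullet> y)"
  unfolding inner_l2_def
  by (intro summable_sums summable_mult_of_sq l2_summable_sq)

context weighted_manifold
begin

text \<open>The denominator of a Rayleigh quotient does not vanish.\<close>

lemma integral_square_pos:
  fixes u :: "'a \<Rightarrow> real"
  assumes "Ck_map (Suc 0) A u" "u \<noteq> (\<lambda>_. 0)"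
  shows "0 < (\<integral>p. (u p)\<^sup>2 \<partial>\<mu>)"
proof (rule ccontr)
  assume n: "\<not> 0 < (\<integral>p. (u p)\<^sup>2 \<partial>\<mu>)"
  have "0 \<le> (\<integral>p. (u p)\<^sup>2 \<partial>\<mu>)"
    by (intro integral_nonneg_AE AE_I2) simp
  with n have "(\<integral>p. (u p)\<^sup>2 \<partial>\<mu>) = 0" by linarith
  then have "(u p)\<^sup>2 = 0" for p
    using Ck_map_1_continuous[OF assms(1)]
    by (intro continuous_nonneg_integral_zero[of "\<lambda>p. (u p)\<^sup>2"] continuous_on_power) auto
  with assms(2) show False by auto
qed

text \<open>Subtract the mean value from a nonconstant function.\<close>

lemma test_function_exists: "test_functions A \<mu> \<noteq> {}"
proof -
  obtain u :: "'a \<Rightarrow> real" and p q where u: "Ck_map (Suc 0) A u" "u p \<noteq> u q"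
    using exists_nonconstant_C1 by blast
  define m where "m = (\<integral>p. u p \<partial>\<mu>) / measure \<mu> UNIV"
  define w where "w p = u p + (- m)" for p
  have "Ck_map (Suc 0) A w"
    unfolding w_def by (intro Ck_map_1_add u Ck_map_const)
  moreover have "(\<integral>p. w p \<partial>\<mu>) = 0"
    using total_volume_pos integrable_continuous[OF Ck_map_1_continuous[OF u(1)]]
    by (simp add: w_def m_def space_volume)
  moreover have "w \<noteq> (\<lambda>_. 0)"
    using u(2) unfolding w_def fun_eq_iff by (metis add_right_cancel)
  ultimately have "w \<in> test_functions A \<mu>" by (simp add: test_functions_def)
  then show ?thesis by blast
qed

lemma norm_square_sums:
  fixes \<phi> :: "'a \<Rightarrow> l2"
  assumes \<phi>: "Ck_map (Suc 0) A \<phi>"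
  shows "(\<lambda>k. \<integral>p. (l2_nth (\<phi> p) k)\<^sup>2 \<partial>\<mu>) sums (\<integral>p. (norm (\<phi> p))\<^sup>2 \<partial>\<mu>)"
proof (rule sums_integral_continuous)
  show "(\<lambda>k. (l2_nth (\<phi> p) k)\<^sup>2) sums (norm (\<phi> p))\<^sup>2" for p
    using l2_inner_sums[of "\<phi> p" "\<phi> p"]
    unfolding power2_norm_eq_inner by (simp add: power2_eq_square)
qed (auto intro!: continuous_on_power continuous_on_norm Ck_map_1_continuous[OF \<phi>]
      Ck_map_1_continuous[OF Ck_map_bounded_linear[OF bounded_linear_l2_nth \<phi>]])

lemma
  fixes \<phi> :: "'a \<Rightarrow> l2"
  assumes \<phi>: "smooth_map A \<phi>"
  shows integral_normalized_norm_square: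
      "(\<integral>p. (norm (\<phi> p))\<^sup>2 \<partial>normalized \<mu>) = (\<integral>p. (norm (\<phi> p))\<^sup>2 \<partial>\<mu>) / measure \<mu> UNIV"
    and integral_normalized_eq_0_iff: "(\<integral>p. \<phi> p \<partial>normalized \<mu>) = 0 \<longleftrightarrow> (\<integral>p. \<phi> p \<partial>\<mu>) = 0"
proof -
  have c: "continuous_on UNIV \<phi>"
    using \<phi> by (intro Ck_map_1_continuous smooth_map_imp_Ck_map)
  then have "continuous_on UNIV (\<lambda>p. (norm (\<phi> p))\<^sup>2)" by (intro continuous_intros)
  from integral_normalized[OF this]
  show "(\<integral>p. (norm (\<phi> p))\<^sup>2 \<partial>normalized \<mu>) = (\<integral>p. (norm (\<phi> p))\<^sup>2 \<partial>\<mu>) / measure \<mu> UNIV"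
    by (simp add: divide_inverse mult.commute)
  show "(\<integral>p. \<phi> p \<partial>normalized \<mu>) = 0 \<longleftrightarrow> (\<integral>p. \<phi> p \<partial>\<mu>) = 0"
    unfolding integral_normalized[OF c] using total_volume_pos by simp
qed

end

locale cometric_manifold = weighted_manifold A \<mu>
  for A :: "('a::{t2_space, second_countable_topology}, 'n::finite) chart set" and \<mu> +
  fixes g :: "('a, 'n) tensor2"
  assumes cometric: "g \<in> Mstar A"
begin

lemma sym_contra2_g: "sym_contra2 A g"
  using cometric by (simp add: Mstar_def)

lemma psd_g: "c \<in> A \<Longrightarrow> p \<in> chart_dom c \<Longrightarrow> psd (g c p)"
  using cometric unfolding Mstar_def sym_contra2_def psd_def by blast

lemma g_symmetric: "c \<in> A \<Longrightarrow> p \<in> chart_dom c \<Longrightarrow> g c p $ i $ j = g c p $ j $ i"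
  by (intro psd_symmetric psd_g)

lemma pairing_nonneg:
  assumes "\<And>c v. c \<in> A \<Longrightarrow> p \<in> chart_dom c \<Longrightarrow> 0 \<le> v \<bullet> (k c p *v v)"
  shows "0 \<le> pairing A g k p"
  unfolding pairing_eq_contraction
  by (intro contraction_psd_nonneg psd_g assms chart_at)

lemma cometric_nonneg: "0 \<le> cometric_d A g u u p"
  unfolding cometric_d_eq_pairing
  by (intro pairing_nonneg) (simp add: mixed_pullback_quadratic_form)

lemma continuous_cometric:
  "Ck_map (Suc 0) A u \<Longrightarrow> Ck_map (Suc 0) A v \<Longrightarrow> continuous_on UNIV (cometric_d A g u v)"
  by (rule continuous_cometric_d[OF sym_contra2_g])

lemma cometric_combination:
  assumes "Ck_map (Suc 0) A u" "Ck_map (Suc 0) A v"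
  shows "cometric_d A g (\<lambda>p. u p + t * v p) (\<lambda>p. u p + t * v p) p =
    cometric_d A g u u p + 2 * t * cometric_d A g u v p + t\<^sup>2 * cometric_d A g v v p"
proof -
  define c where "c = chart_at A p"
  have c: "c \<in> A" "p \<in> chart_dom c" unfolding c_def by (rule chart_at)+
  define a where "a i = chart_partial c i u p" for i
  define b where "b i = chart_partial c i v p" for i
  have ab: "chart_partial c i (\<lambda>p. u p + t * v p) p = a i + t * b i" for i
    using chart_partial_combination[OF assms c] by (simp add: a_def b_def)
  have "(\<Sum>i\<in>UNIV. \<Sum>j\<in>UNIV. g c p $ i $ j * b i * a j) = (\<Sum>j\<in>UNIV. \<Sum>i\<in>UNIV. g c p $ i $ j * b i * a j)"
    by (rule sum.swap)
  also have "\<dots> = (\<Sum>i\<in>UNIV. \<Sum>j\<in>UNIV. g c p $ i $ j * a i * b j)"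
    by (intro sum.cong refl) (simp add: g_symmetric[OF c] mult_ac)
  finally have sw: "(\<Sum>i\<in>UNIV. \<Sum>j\<in>UNIV. g c p $ i $ j * b i * a j) =
    (\<Sum>i\<in>UNIV. \<Sum>j\<in>UNIV. g c p $ i $ j * a i * b j)" .
  have "(\<Sum>i\<in>UNIV. \<Sum>j\<in>UNIV. g c p $ i $ j * (a i + t * b i) * (a j + t * b j)) =
    (\<Sum>i\<in>UNIV. \<Sum>j\<in>UNIV. g c p $ i $ j * a i * a j + t * (g c p $ i $ j * a i * b j)
      + t * (g c p $ i $ j * b i * a j) + t\<^sup>2 * (g c p $ i $ j * b i * b j))"
    by (intro sum.cong refl) (simp add: power2_eq_square algebra_simps)
  also have "\<dots> = (\<Sum>i\<in>UNIV. \<Sum>j\<in>UNIV. g c p $ i $ j * a i * a j)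
      + t * (\<Sum>i\<in>UNIV. \<Sum>j\<in>UNIV. g c p $ i $ j * a i * b j)
      + t * (\<Sum>i\<in>UNIV. \<Sum>j\<in>UNIV. g c p $ i $ j * b i * a j)
      + t\<^sup>2 * (\<Sum>i\<in>UNIV. \<Sum>j\<in>UNIV. g c p $ i $ j * b i * b j)"
    by (simp only: sum.distrib sum_distrib_left)
  finally show ?thesis
    unfolding cometric_d_def Let_def c_def[symmetric] ab sw a_def[symmetric] b_def[symmetric]
    by simp
qed

lemma cometric_const: "cometric_d A g u (\<lambda>_. a) p = 0"
  by (simp add: cometric_d_def chart_partial_const)

lemma cometric_in_chart:
  assumes "Ck_map (Suc 0) A u" "c \<in> A" "p \<in> chart_dom c"
  shows "cometric_d A g u u p =
    (\<chi> i. chart_partial c i u p) \<bullet> (g c p *v (\<chi> i. chart_partial c i u p))"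
  unfolding cometric_d_eq_pairing
  by (simp add: pairing_in_chart[OF sym_contra2_g covariant_law_mixed_pullback[OF assms(1,1)] assms(2,3)]
      contraction_def quadratic_form_sum mixed_pullback_def mult_ac)

lemma rayleigh_nonneg: "0 \<le> rayleigh A \<mu> g u"
  unfolding rayleigh_def
  by (intro divide_nonneg_nonneg integral_nonneg_AE AE_I2) (auto simp: cometric_nonneg)

lemma lambda1_real: obtains l where "0 \<le> l" "lambda1 A \<mu> g = ennreal l"
proof -
  obtain u where "u \<in> test_functions A \<mu>" using test_function_exists by blast
  then have "lambda1 A \<mu> g \<le> ennreal (rayleigh A \<mu> g u)"
    unfolding lambda1_def by (rule INF_lower)
  then have "lambda1 A \<mu> g < \<infinity>"
    by (rule le_less_trans) simp
  then show thesis
    using that by (cases "lambda1 A \<mu> g" rule: ennreal_cases) auto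
qed

lemma lambda1_le_rayleigh:
  assumes "lambda1 A \<mu> g = ennreal l" "u \<in> test_functions A \<mu>"
  shows "l \<le> rayleigh A \<mu> g u"
proof -
  have "ennreal l \<le> ennreal (rayleigh A \<mu> g u)"
    unfolding assms(1)[symmetric] lambda1_def using assms(2) by (rule INF_lower)
  then show ?thesis using rayleigh_nonneg by (simp add: ennreal_le_iff)
qed

text \<open>The Poincare inequality, with the zero function included so that it applies to every component of a
  map.\<close>

lemma spectral_gap:
  assumes l: "lambda1 A \<mu> g = ennreal l" and u: "Ck_map (Suc 0) A u" "(\<integral>p. u p \<partial>\<mu>) = 0"
  shows "l * (\<integral>p. (u p)\<^sup>2 \<partial>\<mu>) \<le> (\<integral>p. cometric_d A g u u p \<partial>\<mu>)"
proof (cases "u = (\<lambda>_. 0)")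
  case True
  then show ?thesis by (simp add: cometric_const)
next
  case False
  then have "u \<in> test_functions A \<mu>" using u by (simp add: test_functions_def)
  from lambda1_le_rayleigh[OF l this] integral_square_pos[OF u(1) False] show ?thesis
    by (simp add: rayleigh_def field_simps)
qed

text \<open>The zero function belongs to both sides; a nonzero function with mean value zero attains the infimum
  iff equality holds in the spectral gap inequality.\<close>

lemma minimizer_iff:
  assumes l: "0 \<le> l" "lambda1 A \<mu> g = ennreal l" and u: "Ck_map (Suc 0) A u" "(\<integral>p. u p \<partial>\<mu>) = 0"
  shows "rayleigh_minimizer A \<mu> g u \<or> (\<forall>p. u p = 0) \<longleftrightarrow>
    l * (\<integral>p. (u p)\<^sup>2 \<partial>\<mu>) = (\<integral>p. cometric_d A g u u p \<partial>\<mu>)"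
proof (cases "u = (\<lambda>_. 0)")
  case True
  then show ?thesis by (simp add: cometric_const)
next
  case False
  then have t: "u \<in> test_functions A \<mu>" using u by (simp add: test_functions_def)
  have "rayleigh_minimizer A \<mu> g u \<longleftrightarrow> rayleigh A \<mu> g u = l"
  proof
    assume m: "rayleigh_minimizer A \<mu> g u"
    have "lambda1 A \<mu> g = ennreal (rayleigh A \<mu> g u)"
      unfolding lambda1_def
    proof (rule antisym)
      show "(INF u\<in>test_functions A \<mu>. ennreal (rayleigh A \<mu> g u)) \<le> ennreal (rayleigh A \<mu> g u)"
        using t by (rule INF_lower)
      show "ennreal (rayleigh A \<mu> g u) \<le> (INF u\<in>test_functions A \<mu>. ennreal (rayleigh A \<mu> g u))"
        using m by (intro INF_greatest ennreal_leI) (auto simp: rayleigh_minimizer_def)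
    qed
    then show "rayleigh A \<mu> g u = l"
      using l rayleigh_nonneg by simp
  next
    assume "rayleigh A \<mu> g u = l"
    then show "rayleigh_minimizer A \<mu> g u"
      using t lambda1_le_rayleigh[OF l(2)] by (simp add: rayleigh_minimizer_def)
  qed
  also have "\<dots> \<longleftrightarrow> l * (\<integral>p. (u p)\<^sup>2 \<partial>\<mu>) = (\<integral>p. cometric_d A g u u p \<partial>\<mu>)"
    using integral_square_pos[OF u(1) False] by (auto simp: rayleigh_def field_simps)
  finally show ?thesis using False by auto
qed

text \<open>The first variation. Replace \<open>v\<close> by \<open>w = v - a\<close> with \<open>a\<close> the mean of \<open>v\<close>; this changes neither \<open>dv\<close> nor, as
  \<open>u\<close> has mean value zero, \<open>\<integral> u v\<close>. Then \<open>u + t w\<close> is admissible for every \<open>t\<close>, so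
  \<open>E(u + t w) - l \<integral> (u + t w)\<^sup>2\<close> is nonnegative; it vanishes at \<open>t = 0\<close>, so its linear coefficient \<open>2 B\<close>
  is zero.\<close>

lemma minimizer_weak_equation:
  assumes m: "rayleigh_minimizer A \<mu> g u" and v: "Ck_map (Suc 0) A v"
  shows "(\<integral>p. cometric_d A g u v p \<partial>\<mu>) = rayleigh A \<mu> g u * (\<integral>p. u p * v p \<partial>\<mu>)"
proof -
  obtain l where l: "0 \<le> l" "lambda1 A \<mu> g = ennreal l" by (rule lambda1_real)
  have u: "Ck_map (Suc 0) A u" "(\<integral>p. u p \<partial>\<mu>) = 0" "u \<noteq> (\<lambda>_. 0)"
    using m by (auto simp: rayleigh_minimizer_def test_functions_def)
  have eq: "l * (\<integral>p. (u p)\<^sup>2 \<partial>\<mu>) = (\<integral>p. cometric_d A g u u p \<partial>\<mu>)"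
    using minimizer_iff[OF l u(1,2)] m by blast
  then have lr: "l = rayleigh A \<mu> g u"
    using integral_square_pos[OF u(1,3)] by (simp add: rayleigh_def field_simps)
  define a where "a = (\<integral>p. v p \<partial>\<mu>) / measure \<mu> UNIV"
  define w where "w p = v p + (- a)" for p
  have w: "Ck_map (Suc 0) A w"
    unfolding w_def by (intro Ck_map_1_add v Ck_map_const)
  have cu: "continuous_on UNIV u" and cv: "continuous_on UNIV v" and cw: "continuous_on UNIV w"
    using u v w by (auto intro: Ck_map_1_continuous)
  have w0: "(\<integral>p. w p \<partial>\<mu>) = 0"
    using total_volume_pos integrable_continuous[OF cv]
    by (simp add: w_def a_def space_volume)
  have "chart_partial (chart_at A p) i w p = chart_partial (chart_at A p) i v p" for i p
    using chart_partial_add[OF v Ck_map_const[of "- a"] chart_at[of p], of i]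
    unfolding w_def[abs_def] by (simp add: chart_partial_const)
  then have dw: "cometric_d A g u w = cometric_d A g u v"
    by (simp add: fun_eq_iff cometric_d_def Let_def)
  have iu: "integrable \<mu> u" "integrable \<mu> (\<lambda>p. (u p)\<^sup>2)" "integrable \<mu> w"
    "integrable \<mu> (\<lambda>p. u p * v p)"
    "integrable \<mu> (\<lambda>p. u p * w p)" "integrable \<mu> (\<lambda>p. (w p)\<^sup>2)"
    "integrable \<mu> (cometric_d A g u u)" "integrable \<mu> (cometric_d A g u w)"
    "integrable \<mu> (cometric_d A g w w)"
    by (intro integrable_continuous continuous_cometric continuous_intros cu cv cw u(1) w)+
  define B where "B = (\<integral>p. cometric_d A g u w p \<partial>\<mu>) - l * (\<integral>p. u p * w p \<partial>\<mu>)"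
  define C where "C = (\<integral>p. cometric_d A g w w p \<partial>\<mu>) - l * (\<integral>p. (w p)\<^sup>2 \<partial>\<mu>)"
  have nonneg: "0 \<le> 2 * t * B + t\<^sup>2 * C" for t
  proof -
    have "(\<integral>p. u p + t * w p \<partial>\<mu>) = 0"
      using iu by (simp add: u(2) w0)
    from spectral_gap[OF l(2) Ck_map_1_combination[OF u(1) w] this]
    moreover have "(\<integral>p. cometric_d A g (\<lambda>p. u p + t * w p) (\<lambda>p. u p + t * w p) p \<partial>\<mu>) =
        (\<integral>p. cometric_d A g u u p \<partial>\<mu>) + 2 * t * (\<integral>p. cometric_d A g u w p \<partial>\<mu>) +
        t\<^sup>2 * (\<integral>p. cometric_d A g w w p \<partial>\<mu>)"
      unfolding cometric_combination[OF u(1) w] using iu by simp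
    moreover have "(\<integral>p. (u p + t * w p)\<^sup>2 \<partial>\<mu>) =
        (\<integral>p. (u p)\<^sup>2 \<partial>\<mu>) + 2 * t * (\<integral>p. u p * w p \<partial>\<mu>) + t\<^sup>2 * (\<integral>p. (w p)\<^sup>2 \<partial>\<mu>)"
    proof -
      have "(u p + t * w p)\<^sup>2 = (u p)\<^sup>2 + 2 * t * (u p * w p) + t\<^sup>2 * (w p)\<^sup>2" for p
        by (simp add: power2_eq_square algebra_simps)
      then show ?thesis using iu by simp
    qed
    ultimately show ?thesis
      using eq by (simp add: B_def C_def algebra_simps)
  qed
  have "2 * B = 0"
  proof (rule DERIV_local_min[of "\<lambda>t. 2 * t * B + t\<^sup>2 * C" _ 0 1])
    show "((\<lambda>t. 2 * t * B + t\<^sup>2 * C) has_real_derivative 2 * B) (at 0)"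
      by (auto intro!: derivative_eq_intros)
  qed (use nonneg in auto)
  moreover have "(\<integral>p. u p * w p \<partial>\<mu>) = (\<integral>p. u p * v p \<partial>\<mu>)"
  proof -
    have "(\<integral>p. u p * w p \<partial>\<mu>) = (\<integral>p. u p * v p - a * u p \<partial>\<mu>)"
      by (simp add: w_def algebra_simps)
    also have "\<dots> = (\<integral>p. u p * v p \<partial>\<mu>)"
      using iu(1,4) u(2) by simp
    finally show ?thesis .
  qed
  ultimately show ?thesis
    by (simp add: B_def dw lr)
qed

text \<open>If the energy vanishes, then so do \<open>g\<^sup>*(du, du)\<close> and, as \<open>g\<^sup>*\<close> is positive definite, \<open>du\<close>. By connectedness
  \<open>u\<close> is constant, and a constant with mean value zero is zero.\<close>

lemma rayleigh_pos:
  assumes "pos_def A g" "u \<in> test_functions A \<mu>"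
  shows "0 < rayleigh A \<mu> g u"
proof (rule ccontr)
  assume n: "\<not> 0 < rayleigh A \<mu> g u"
  have u: "Ck_map (Suc 0) A u" "(\<integral>p. u p \<partial>\<mu>) = 0" "u \<noteq> (\<lambda>_. 0)"
    using assms(2) by (auto simp: test_functions_def)
  have "rayleigh A \<mu> g u = 0" using n rayleigh_nonneg[of u] by linarith
  then have "(\<integral>p. cometric_d A g u u p \<partial>\<mu>) = 0"
    using integral_square_pos[OF u(1,3)] by (simp add: rayleigh_def)
  then have z: "cometric_d A g u u p = 0" for p
    by (rule continuous_nonneg_integral_zero[OF continuous_cometric[OF u(1,1)] cometric_nonneg])
  have "chart_partial c i u p = 0" if "c \<in> A" "p \<in> chart_dom c" for c i p
  proof -
    have "(\<chi> i. chart_partial c i u p) = 0"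
      using z[of p] assms(1) that unfolding cometric_in_chart[OF u(1) that] pos_def_def
      by (metis less_irrefl)
    then show ?thesis by (simp add: vec_eq_iff)
  qed
  then have "eventually (\<lambda>q. u p = u q) (at p within UNIV)" for p
    using locally_constant_of_zero_partials[OF u(1)] by blast
  then have const: "u p = u q" for p q
    by (intro connected_local_const[OF connected]) auto
  have "(\<integral>p. u p \<partial>\<mu>) = (\<integral>p. u undefined \<partial>\<mu>)"
    by (intro Bochner_Integration.integral_cong refl const)
  then have "u undefined = 0"
    using u(2) total_volume_pos by (simp add: space_volume)
  with u(3) const show False by (metis ext)
qed

text \<open>The weak equation is the eigenvalue equation. An eigenfunction \<open>w\<close> of another eigenvalue \<open>l' > 0\<close> has
  mean value zero (test with the constant \<open>1\<close>) and Rayleigh quotient \<open>l'\<close> (test with \<open>w\<close>), so minimality of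
  \<open>u\<close> gives \<open>l \<le> l'\<close>.\<close>

lemma minimizer_first_eigenfunction:
  assumes pd: "pos_def A g" and m: "rayleigh_minimizer A \<mu> g u" and s: "smooth_map A u"
  shows "first_eigenfunction A \<mu> g u"
proof -
  define l where "l = rayleigh A \<mu> g u"
  have t: "u \<in> test_functions A \<mu>" and min: "\<And>v. v \<in> test_functions A \<mu> \<Longrightarrow> l \<le> rayleigh A \<mu> g v"
    using m by (auto simp: rayleigh_minimizer_def l_def)
  have "0 < l" using rayleigh_pos[OF pd t] by (simp add: l_def)
  have "smooth_map A (\<lambda>p. - (l * u p))"
    using smooth_map_bounded_linear[OF bounded_linear_mult_right[of "- l"] s] by simp
  moreover have "(\<integral>p. - (l * u p) * v p \<partial>\<mu>) = - (\<integral>p. cometric_d A g u v p \<partial>\<mu>)" if "smooth_map A v" for v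
  proof -
    have "(\<integral>p. - (l * u p) * v p \<partial>\<mu>) = (\<integral>p. - l * (u p * v p) \<partial>\<mu>)"
      by (simp add: mult.assoc)
    also have "\<dots> = - (l * (\<integral>p. u p * v p \<partial>\<mu>))"
      by simp
    finally show ?thesis
      using minimizer_weak_equation[OF m smooth_map_imp_Ck_map[OF that]] by (simp add: l_def)
  qed
  ultimately have e: "u \<in> eigenspace A \<mu> g l"
    using s by (simp add: eigenspace_def has_BE_laplacian_def)
  have "l \<le> l'" if l': "0 < l'" "eigenvalue A \<mu> g l'" for l'
  proof -
    obtain w where w: "has_BE_laplacian A \<mu> g w (\<lambda>p. - (l' * w p))" "w \<noteq> (\<lambda>_. 0)"
      using l'(2) by (auto simp: eigenvalue_def eigenspace_def)
    then have sw: "smooth_map A w" and weak: "\<And>v. smooth_map A v \<Longrightarrow>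
        (\<integral>p. - (l' * w p) * v p \<partial>\<mu>) = - (\<integral>p. cometric_d A g w v p \<partial>\<mu>)"
      by (auto simp: has_BE_laplacian_def)
    have Cw: "Ck_map (Suc 0) A w" using sw by (rule smooth_map_imp_Ck_map)
    have "smooth_map A (\<lambda>_. 1 :: real)"
    proof -
      have "in_chart c (\<lambda>_. 1 :: real) = (\<lambda>_. 1)" for c :: "('a, 'n) chart"
        by (simp add: in_chart_def o_def)
      moreover have "Ck_on k S (\<lambda>_. a)" for k and S :: "(real^'n) set" and a :: real
        by (induction k arbitrary: a) auto
      ultimately show ?thesis by (simp add: smooth_map_def smooth_on_def)
    qed
    from weak[OF this] l'(1) have "(\<integral>p. w p \<partial>\<mu>) = 0"
      by (simp add: cometric_const)
    with Cw w(2) have "w \<in> test_functions A \<mu>" by (simp add: test_functions_def)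
    moreover have "rayleigh A \<mu> g w = l'"
    proof -
      have "l' * (\<integral>p. (w p)\<^sup>2 \<partial>\<mu>) = (\<integral>p. cometric_d A g w w p \<partial>\<mu>)"
        using weak[OF sw] by (simp add: power2_eq_square mult.assoc)
      then show ?thesis
        using integral_square_pos[OF Cw w(2)] by (simp add: rayleigh_def field_simps)
    qed
    ultimately show ?thesis using min by metis
  qed
  moreover have "eigenvalue A \<mu> g l"
    using e t by (auto simp: eigenvalue_def test_functions_def)
  ultimately show ?thesis
    using \<open>0 < l\<close> e by (auto simp: first_eigenfunction_def)
qed

text \<open>Pointwise this is Parseval: the inner product of two partial derivatives of \<open>\<phi>\<close> in \<open>l\<^sup>2\<close> is the sum of
  the products of the partial derivatives of the components.\<close>

lemma energy_sums:
  fixes \<phi> :: "'a \<Rightarrow> l2"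
  assumes \<phi>: "Ck_map (Suc 0) A \<phi>"
  shows "(\<lambda>k. \<integral>p. cometric_d A g (\<lambda>p. l2_nth (\<phi> p) k) (\<lambda>p. l2_nth (\<phi> p) k) p \<partial>\<mu>)
      sums (\<integral>p. pairing A g (pullback_metric \<phi>) p \<partial>\<mu>)"
proof (rule sums_integral_continuous)
  show "continuous_on UNIV (pairing A g (pullback_metric \<phi>))"
    unfolding pullback_metric_eq_mixed
    by (intro continuous_pairing sym_contra2_g covariant_law_mixed_pullback continuous_mixed_pullback \<phi>)
  show "(\<lambda>k. cometric_d A g (\<lambda>p. l2_nth (\<phi> p) k) (\<lambda>p. l2_nth (\<phi> p) k) p) sums
      pairing A g (pullback_metric \<phi>) p" for p
    unfolding cometric_d_def pairing_def Let_def pullback_metric_def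
      chart_partial_bounded_linear[OF bounded_linear_l2_nth \<phi> chart_at] vec_lambda_beta mult.assoc
    by (intro sums_sum sums_mult l2_inner_sums)
qed (auto intro!: continuous_cometric cometric_nonneg Ck_map_bounded_linear[OF bounded_linear_l2_nth \<phi>])

end

section \<open>Weak duality\<close>

lemma ennreal_le_inverse_of_mult_le_1:
  fixes x y :: ennreal
  assumes "x * y \<le> 1"
  shows "x \<le> 1 / y"
proof (cases "y = 0 \<or> y = \<infinity>")
  case True
  then show ?thesis
    using assms by (auto simp: ennreal_mult_top top_unique split: if_splits)
next
  case False
  have "x = x * y / y"
    using False by (simp add: ennreal_mult_divide_eq)
  also have "\<dots> \<le> 1 / y"
    using assms by (rule divide_right_mono_ennreal)
  finally show ?thesis .
qed

locale riemannian_cometric_manifold = cometric_manifold A \<mu> g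
  for A :: "('a::{t2_space, second_countable_topology}, 'n::finite) chart set" and \<mu> g +
  fixes h :: "('a, 'n) tensor2"
  assumes metric: "riemannian_metric A h" and nonzero: "nonzero_tensor A g"
begin

lemma covariant_law_metric: "covariant_law A h"
  using metric unfolding riemannian_metric_def sym_cov2_def covariant_law_def by blast

lemma continuous_metric: "c \<in> A \<Longrightarrow> continuous_on (chart_dom c) (h c)"
proof -
  assume c: "c \<in> A"
  have "Ck_on 0 (chart_ran c) (in_chart c (h c))"
    using metric c unfolding riemannian_metric_def sym_cov2_def smooth_on_def by blast
  then show "continuous_on (chart_dom c) (h c)"
    using c by (intro continuous_on_chart_dom) auto
qed

lemma metric_pos: "c \<in> A \<Longrightarrow> p \<in> chart_dom c \<Longrightarrow> v \<noteq> 0 \<Longrightarrow> 0 < v \<bullet> (h c p *v v)"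
  using metric unfolding riemannian_metric_def pos_def_def by blast

text \<open>Contraction with a positive definite form detects every nonzero semidefinite matrix.\<close>

lemma integral_pairing_metric_pos: "0 < (\<integral>p. pairing A g h p \<partial>\<mu>)"
proof (rule ccontr)
  assume n: "\<not> 0 < (\<integral>p. pairing A g h p \<partial>\<mu>)"
  have nn: "0 \<le> pairing A g h p" for p
  proof (rule pairing_nonneg)
    show "0 \<le> v \<bullet> (h c p *v v)" if "c \<in> A" "p \<in> chart_dom c" for c v
      using metric_pos[OF that, of v] by (cases "v = 0") auto
  qed
  have "0 \<le> (\<integral>p. pairing A g h p \<partial>\<mu>)"
    by (intro integral_nonneg_AE AE_I2 nn)
  with n have "(\<integral>p. pairing A g h p \<partial>\<mu>) = 0" by linarith
  then have z: "pairing A g h p = 0" for p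
    by (intro continuous_nonneg_integral_zero[OF continuous_pairing nn]
        sym_contra2_g covariant_law_metric continuous_metric)
  have "g c p = 0" if c: "c \<in> A" "p \<in> chart_dom c" for c p
    using pairing_in_chart[OF sym_contra2_g covariant_law_metric c] z[of p]
    by (intro contraction_psd_eq_0[OF psd_g[OF c] metric_pos[OF c]]) auto
  then show False
    using nonzero by (simp add: nonzero_tensor_def tensor_eq_def)
qed

text \<open>The heart of the argument. With \<open>S = (g\<^sup>*, h - \<phi>\<^sup>*h\<^sub>l\<^sub>2)\<close> and \<open>d\<^sub>k\<close> the defect of the spectral gap inequality
  for the \<open>k\<close>-th component, the defect of the inequality is \<open>\<integral> S + \<Sum>\<^sub>k d\<^sub>k\<close>, a sum of nonnegative terms.\<close>

lemma
  fixes \<phi> :: "'a \<Rightarrow> l2"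
  assumes \<phi>: "smooth_map A \<phi>" "(\<integral>p. \<phi> p \<partial>\<mu>) = 0" "tensor_le A (pullback_metric \<phi>) h"
    and l: "0 \<le> l" "lambda1 A \<mu> g = ennreal l"
  shows variance_le: "l * (\<integral>p. (norm (\<phi> p))\<^sup>2 \<partial>\<mu>) \<le> (\<integral>p. pairing A g h p \<partial>\<mu>)"
    and variance_eq_iff: "l * (\<integral>p. (norm (\<phi> p))\<^sup>2 \<partial>\<mu>) = (\<integral>p. pairing A g h p \<partial>\<mu>) \<longleftrightarrow>
      consists_of (rayleigh_minimizer A \<mu> g) \<phi> \<and>
      (\<forall>p. pairing A g (\<lambda>c q. h c q - pullback_metric \<phi> c q) p = 0)"
proof -
  have C: "Ck_map (Suc 0) A \<phi>" using \<phi>(1) by (rule smooth_map_imp_Ck_map)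
  define u where "u k p = l2_nth (\<phi> p) k" for k p
  have u: "Ck_map (Suc 0) A (u k)" for k
    unfolding u_def[abs_def] using C by (rule Ck_map_bounded_linear[OF bounded_linear_l2_nth])
  have u0: "(\<integral>p. u k p \<partial>\<mu>) = 0" for k
    using integral_bounded_linear[OF bounded_linear_l2_nth integrable_continuous[OF Ck_map_1_continuous[OF C]]]
    by (simp add: u_def \<phi>(2) zero_l2.rep_eq)
  define S where "S = pairing A g (\<lambda>c q. h c q - pullback_metric \<phi> c q)"
  have cp: "continuous_on UNIV (pairing A g (pullback_metric \<phi>))"
    unfolding pullback_metric_eq_mixed
    by (intro continuous_pairing sym_contra2_g covariant_law_mixed_pullback continuous_mixed_pullback C)
  have ch: "continuous_on UNIV (pairing A g h)"
    by (intro continuous_pairing sym_contra2_g covariant_law_metric continuous_metric)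
  have S_eq: "S = (\<lambda>p. pairing A g h p - pairing A g (pullback_metric \<phi>) p)"
    by (simp add: S_def pairing_diff fun_eq_iff)
  have S_cont: "continuous_on UNIV S"
    unfolding S_eq by (intro continuous_on_diff ch cp)
  have S_nonneg: "0 \<le> S p" for p
    unfolding S_def
    using \<phi>(3) by (intro pairing_nonneg)
      (simp add: tensor_le_def matrix_vector_mult_diff_rdistrib inner_diff_right)
  have S_int: "(\<integral>p. S p \<partial>\<mu>) = (\<integral>p. pairing A g h p \<partial>\<mu>) - (\<integral>p. pairing A g (pullback_metric \<phi>) p \<partial>\<mu>)"
    unfolding S_eq by (intro Bochner_Integration.integral_diff integrable_continuous ch cp)
  have "0 \<le> (\<integral>p. S p \<partial>\<mu>)" by (intro integral_nonneg_AE AE_I2 S_nonneg)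
  define d where "d k = (\<integral>p. cometric_d A g (u k) (u k) p \<partial>\<mu>) - l * (\<integral>p. (u k p)\<^sup>2 \<partial>\<mu>)" for k
  have d_nonneg: "0 \<le> d k" for k
    using spectral_gap[OF l(2) u u0] by (simp add: d_def)
  have d_sums: "d sums ((\<integral>p. pairing A g (pullback_metric \<phi>) p \<partial>\<mu>) - l * (\<integral>p. (norm (\<phi> p))\<^sup>2 \<partial>\<mu>))"
    unfolding d_def[abs_def] u_def[abs_def]
    by (intro sums_diff sums_mult energy_sums norm_square_sums C)
  define D where "D = (\<integral>p. pairing A g (pullback_metric \<phi>) p \<partial>\<mu>) - l * (\<integral>p. (norm (\<phi> p))\<^sup>2 \<partial>\<mu>)"
  have D: "d sums D" using d_sums by (simp add: D_def)
  have "0 \<le> D" using sums_le[OF d_nonneg sums_zero D] .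
  have D0: "D = 0 \<longleftrightarrow> (\<forall>k. d k = 0)"
    using suminf_eq_zero_iff[OF sums_summable[OF D] d_nonneg] sums_unique[OF D] by simp
  have sum: "(\<integral>p. pairing A g h p \<partial>\<mu>) - l * (\<integral>p. (norm (\<phi> p))\<^sup>2 \<partial>\<mu>) = (\<integral>p. S p \<partial>\<mu>) + D"
    by (simp add: S_int D_def)
  show "l * (\<integral>p. (norm (\<phi> p))\<^sup>2 \<partial>\<mu>) \<le> (\<integral>p. pairing A g h p \<partial>\<mu>)"
    using sum \<open>0 \<le> D\<close> \<open>0 \<le> (\<integral>p. S p \<partial>\<mu>)\<close> by linarith
  have "l * (\<integral>p. (norm (\<phi> p))\<^sup>2 \<partial>\<mu>) = (\<integral>p. pairing A g h p \<partial>\<mu>) \<longleftrightarrow> D = 0 \<and> (\<integral>p. S p \<partial>\<mu>) = 0"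
    using sum \<open>0 \<le> D\<close> \<open>0 \<le> (\<integral>p. S p \<partial>\<mu>)\<close> by linarith
  moreover have "D = 0 \<longleftrightarrow> consists_of (rayleigh_minimizer A \<mu> g) \<phi>"
  proof -
    have "d k = 0 \<longleftrightarrow> rayleigh_minimizer A \<mu> g (u k) \<or> (\<forall>p. u k p = 0)" for k
      unfolding minimizer_iff[OF l u u0] by (auto simp: d_def)
    then show ?thesis
      unfolding D0 consists_of_def by (simp add: u_def[abs_def])
  qed
  moreover have "(\<integral>p. S p \<partial>\<mu>) = 0 \<longleftrightarrow> (\<forall>p. S p = 0)"
    using continuous_nonneg_integral_zero[OF S_cont S_nonneg] by auto
  ultimately show "l * (\<integral>p. (norm (\<phi> p))\<^sup>2 \<partial>\<mu>) = (\<integral>p. pairing A g h p \<partial>\<mu>) \<longleftrightarrow>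
      consists_of (rayleigh_minimizer A \<mu> g) \<phi> \<and>
      (\<forall>p. pairing A g (\<lambda>c q. h c q - pullback_metric \<phi> c q) p = 0)"
    by (simp add: S_def)
qed

text \<open>The same detection property with the roles exchanged: \<open>h - \<phi>\<^sup>*h\<^sub>l\<^sub>2\<close> is semidefinite and \<open>g\<^sup>*\<close> is
  positive definite.\<close>

lemma isometric_of_zero_pairing:
  assumes pd: "pos_def A g" and \<phi>: "Ck_map (Suc 0) A \<phi>" "tensor_le A (pullback_metric \<phi>) h"
    and z: "\<And>p. pairing A g (\<lambda>c q. h c q - pullback_metric \<phi> c q) p = 0"
  shows "tensor_eq A (pullback_metric \<phi>) h"
  unfolding tensor_eq_def
proof (intro ballI)
  fix c p assume c: "c \<in> A" "p \<in> chart_dom c"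
  define K where "K = h c p - pullback_metric \<phi> c p"
  have cl: "covariant_law A (\<lambda>c q. h c q - pullback_metric \<phi> c q)"
    unfolding pullback_metric_eq_mixed
    by (intro covariant_law_diff covariant_law_metric covariant_law_mixed_pullback \<phi>)
  have "contraction K (g c p) = 0"
    using pairing_in_chart[OF sym_contra2_g cl c] z[of p]
    by (simp add: K_def contraction_commute)
  moreover have "psd K"
    unfolding psd_def
  proof (intro conjI allI)
    have "transpose (h c p) = h c p"
      using metric c unfolding riemannian_metric_def sym_cov2_def by blast
    moreover have "transpose (pullback_metric \<phi> c p) = pullback_metric \<phi> c p"
      by (simp add: pullback_metric_def transpose_def vec_eq_iff inner_commute)
    ultimately show "transpose K = K"
      by (simp add: K_def transpose_def vec_eq_iff)
    show "0 \<le> v \<bullet> (K *v v)" for v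
      using \<phi>(2) c by (simp add: K_def tensor_le_def matrix_vector_mult_diff_rdistrib inner_diff_right)
  qed
  moreover have "v \<noteq> 0 \<Longrightarrow> 0 < v \<bullet> (g c p *v v)" for v
    using pd c by (simp add: pos_def_def)
  ultimately have "K = 0"
    by (intro contraction_psd_eq_0[of K "g c p"])
  then show "pullback_metric \<phi> c p = h c p" by (simp add: K_def)
qed

lemma integral_normalized_pairing_metric:
  "(\<integral>p. pairing A g h p \<partial>normalized \<mu>) = (\<integral>p. pairing A g h p \<partial>\<mu>) / measure \<mu> UNIV"
  using integral_normalized[OF continuous_pairing[OF sym_contra2_g covariant_law_metric continuous_metric]]
  by (simp add: divide_inverse mult.commute)

text \<open>The estimates for \<open>\<mu>\<close> in terms of the normalized measure and extended nonnegative reals. The product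
  form of the inequality is the one that passes to the supremum over \<open>g\<^sup>*\<close>.\<close>

lemma weak_duality:
  assumes \<phi>: "feasible_map A \<mu> h \<phi>"
  shows "ennreal (\<integral>p. (norm (\<phi> p))\<^sup>2 \<partial>normalized \<mu>) \<le> dual_bound A \<mu> h g"
    and "ennreal (\<integral>p. (norm (\<phi> p))\<^sup>2 \<partial>normalized \<mu>) = dual_bound A \<mu> h g \<longleftrightarrow>
      consists_of (rayleigh_minimizer A \<mu> g) \<phi> \<and>
      (\<forall>p. pairing A g (\<lambda>c q. h c q - pullback_metric \<phi> c q) p = 0)"
    and "ennreal (\<integral>p. (norm (\<phi> p))\<^sup>2 \<partial>normalized \<mu>) *
      (lambda1 A \<mu> g / ennreal (\<integral>p. pairing A g h p \<partial>normalized \<mu>)) \<le> 1"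
proof -
  obtain l where l: "0 \<le> l" "lambda1 A \<mu> g = ennreal l" by (rule lambda1_real)
  define N where "N = (\<integral>p. (norm (\<phi> p))\<^sup>2 \<partial>\<mu>)"
  define P where "P = (\<integral>p. pairing A g h p \<partial>\<mu>)"
  define V where "V = measure \<mu> UNIV"
  have V: "0 < V" unfolding V_def by (rule total_volume_pos)
  have P: "0 < P" unfolding P_def by (rule integral_pairing_metric_pos)
  have N: "0 \<le> N" unfolding N_def by (intro integral_nonneg_AE AE_I2) simp
  have \<phi>': "smooth_map A \<phi>" "(\<integral>p. \<phi> p \<partial>\<mu>) = 0" "tensor_le A (pullback_metric \<phi>) h"
    using \<phi> integral_normalized_eq_0_iff by (auto simp: feasible_map_def)
  have Nn: "(\<integral>p. (norm (\<phi> p))\<^sup>2 \<partial>normalized \<mu>) = N / V"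
    unfolding N_def V_def by (rule integral_normalized_norm_square[OF \<phi>'(1)])
  have Pn: "(\<integral>p. pairing A g h p \<partial>normalized \<mu>) = P / V"
    unfolding P_def V_def by (rule integral_normalized_pairing_metric)
  have le: "l * N \<le> P"
    unfolding N_def P_def by (rule variance_le[OF \<phi>' l])
  have eq: "l * N = P \<longleftrightarrow> consists_of (rayleigh_minimizer A \<mu> g) \<phi> \<and>
      (\<forall>p. pairing A g (\<lambda>c q. h c q - pullback_metric \<phi> c q) p = 0)"
    unfolding N_def P_def by (rule variance_eq_iff[OF \<phi>' l])
  have bound: "dual_bound A \<mu> h g = (if l = 0 then \<infinity> else ennreal (P / V / l))"
    unfolding dual_bound_def l(2) Pn using l(1) P V by (auto simp: divide_ennreal)
  show "ennreal (\<integral>p. (norm (\<phi> p))\<^sup>2 \<partial>normalized \<mu>) \<le> dual_bound A \<mu> h g"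
    unfolding Nn bound using l(1) le V by (auto simp: field_simps intro!: ennreal_leI)
  have "ennreal (N / V) = dual_bound A \<mu> h g \<longleftrightarrow> l * N = P"
  proof (cases "l = 0")
    case True
    then show ?thesis using P by (simp add: bound)
  next
    case False
    with l(1) have "0 < l" by simp
    then have "ennreal (N / V) = dual_bound A \<mu> h g \<longleftrightarrow> N / V = P / V / l"
      unfolding bound using N P V by simp
    also have "\<dots> \<longleftrightarrow> l * N = P"
      using \<open>0 < l\<close> V by (simp add: field_simps)
    finally show ?thesis .
  qed
  with eq show "ennreal (\<integral>p. (norm (\<phi> p))\<^sup>2 \<partial>normalized \<mu>) = dual_bound A \<mu> h g \<longleftrightarrow>
      consists_of (rayleigh_minimizer A \<mu> g) \<phi> \<and>
      (\<forall>p. pairing A g (\<lambda>c q. h c q - pullback_metric \<phi> c q) p = 0)"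
    unfolding Nn by simp
  have "ennreal (N / V) * (ennreal l / ennreal (P / V)) = ennreal (N / V * (l / (P / V)))"
    using l(1) N P V by (simp add: divide_ennreal ennreal_mult[symmetric])
  also have "\<dots> \<le> ennreal 1"
    using le P V by (intro ennreal_leI) (simp add: field_simps)
  finally show "ennreal (\<integral>p. (norm (\<phi> p))\<^sup>2 \<partial>normalized \<mu>) *
      (lambda1 A \<mu> g / ennreal (\<integral>p. pairing A g h p \<partial>normalized \<mu>)) \<le> 1"
    unfolding Nn Pn l(2) by simp
qed

lemma equality_case_pos_def:
  assumes pd: "pos_def A g" and \<phi>: "feasible_map A \<mu> h \<phi>"
    and min: "consists_of (rayleigh_minimizer A \<mu> g) \<phi>"
    and zero: "\<forall>p. pairing A g (\<lambda>c q. h c q - pullback_metric \<phi> c q) p = 0"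
  shows "consists_of (first_eigenfunction A \<mu> g) \<phi>" "tensor_eq A (pullback_metric \<phi>) h"
proof -
  have s: "smooth_map A \<phi>" using \<phi> by (simp add: feasible_map_def)
  have "smooth_map A (\<lambda>p. l2_nth (\<phi> p) k)" for k
    using s by (rule smooth_map_bounded_linear[OF bounded_linear_l2_nth])
  then show "consists_of (first_eigenfunction A \<mu> g) \<phi>"
    using min minimizer_first_eigenfunction[OF pd] unfolding consists_of_def by blast
  show "tensor_eq A (pullback_metric \<phi>) h"
    using \<phi> zero by (intro isometric_of_zero_pairing pd smooth_map_imp_Ck_map s)
      (auto simp: feasible_map_def)
qed

end

theorem proposition2p5:
  fixes A :: "('a::{t2_space, second_countable_topology}, 'n::finite) chart set"
    and \<mu> :: "'a measure"
    and h :: "('a, 'n) tensor2"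
  assumes "compact_manifold A"
    and "smooth_volume A \<mu>"
    and "riemannian_metric A h"
  shows "(\<forall>\<phi> g. smooth_map A \<phi> \<and> (\<integral>p. \<phi> p \<partial>normalized \<mu>) = 0 \<and>
            tensor_le A (pullback_metric \<phi>) h \<and> g \<in> Mstar A \<and> nonzero_tensor A g \<longrightarrow>
            ennreal (\<integral>p. (norm (\<phi> p))\<^sup>2 \<partial>normalized \<mu>) \<le> dual_bound A \<mu> h g \<and>
            (ennreal (\<integral>p. (norm (\<phi> p))\<^sup>2 \<partial>normalized \<mu>) = dual_bound A \<mu> h g \<longleftrightarrow>
               consists_of (rayleigh_minimizer A \<mu> g) \<phi> \<and>
               (\<forall>p. pairing A g (\<lambda>c q. h c q - pullback_metric \<phi> c q) p = 0)) \<and>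
            (pos_def A g \<longrightarrow>
               consists_of (rayleigh_minimizer A \<mu> g) \<phi> \<and>
               (\<forall>p. pairing A g (\<lambda>c q. h c q - pullback_metric \<phi> c q) p = 0) \<longrightarrow>
               consists_of (first_eigenfunction A \<mu> g) \<phi> \<and>
               tensor_eq A (pullback_metric \<phi>) h)) \<and>
         Var A \<mu> h \<le> 1 / Lambda1 A \<mu> h"
proof (intro conjI allI impI)
  have loc: "riemannian_cometric_manifold A \<mu> g h" if "g \<in> Mstar A" "nonzero_tensor A g" for g
    using assms that by unfold_locales (auto simp: compact_manifold_def)
  {
    fix \<phi> :: "'a \<Rightarrow> l2" and g :: "('a, 'n) tensor2"
    assume a: "smooth_map A \<phi> \<and> (\<integral>p. \<phi> p \<partial>normalized \<mu>) = 0 \<and>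
            tensor_le A (pullback_metric \<phi>) h \<and> g \<in> Mstar A \<and> nonzero_tensor A g"
    then interpret riemannian_cometric_manifold A \<mu> g h by (intro loc) auto
    have f: "feasible_map A \<mu> h \<phi>" using a by (simp add: feasible_map_def)
    show "ennreal (\<integral>p. (norm (\<phi> p))\<^sup>2 \<partial>normalized \<mu>) \<le> dual_bound A \<mu> h g"
      using f by (rule weak_duality)
    show "ennreal (\<integral>p. (norm (\<phi> p))\<^sup>2 \<partial>normalized \<mu>) = dual_bound A \<mu> h g \<longleftrightarrow>
               consists_of (rayleigh_minimizer A \<mu> g) \<phi> \<and>
               (\<forall>p. pairing A g (\<lambda>c q. h c q - pullback_metric \<phi> c q) p = 0)"
      using f by (rule weak_duality)
    assume "pos_def A g" "consists_of (rayleigh_minimizer A \<mu> g) \<phi> \<and>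
               (\<forall>p. pairing A g (\<lambda>c q. h c q - pullback_metric \<phi> c q) p = 0)"
    then show "consists_of (first_eigenfunction A \<mu> g) \<phi>" "tensor_eq A (pullback_metric \<phi>) h"
      using equality_case_pos_def[OF _ f] by blast+
  }
  show "Var A \<mu> h \<le> 1 / Lambda1 A \<mu> h"
    unfolding Var_def
  proof (intro SUP_least ennreal_le_inverse_of_mult_le_1)
    fix \<phi> assume \<phi>: "\<phi> \<in> Collect (feasible_map A \<mu> h)"
    show "ennreal (\<integral>p. (norm (\<phi> p))\<^sup>2 \<partial>normalized \<mu>) * Lambda1 A \<mu> h \<le> 1"
      unfolding Lambda1_def SUP_mult_left_ennreal
    proof (rule SUP_least)
      fix g assume "g \<in> {g \<in> Mstar A. nonzero_tensor A g}"
      then interpret riemannian_cometric_manifold A \<mu> g h by (intro loc) auto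
      show "ennreal (\<integral>p. (norm (\<phi> p))\<^sup>2 \<partial>normalized \<mu>) *
          (lambda1 A \<mu> g / ennreal (\<integral>p. pairing A g h p \<partial>normalized \<mu>)) \<le> 1"
        using \<phi> by (intro weak_duality) simp
    qed
  qed
qed

end
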